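(* Let $n\geqslant 2$, let $\Omega\subset\mathbb{R}^n$ be a bounded convex domain, and write $d_x=\operatorname{dist}(x,\partial\Omega)$. Let $f:\Omega\times(-\infty,0)\times\mathbb{R}^n\to\mathbb{R}$ satisfy: $(f_1)$ $f\in C(\Omega\times(-\infty,0)\times\mathbb{R}^n)$; $(f_2)$ for all $x\in\Omega$ and $q\in\mathbb{R}^n$, $f(x,z,q)$ is non-decreasing in $z\in(-\infty,0)$; $(f_3)$ there are constants $A>0$, $\alpha\in\mathbb{R}$, $\beta\geqslant n+1$ and $\gamma<\min\{n+\alpha,\beta-n+1\}$ such that $$0<f(x,z,q)\leqslant A\,d_x^{\beta-n-1}|z|^{-\alpha}(1+|q|^2)^{\frac{\gamma}{2}}\quad\text{for all }(x,z,q)\in\Omega\times(-\infty,0)\times\mathbb{R}^n.$$ Then the Dirichlet problem $$\det D^2u=f(x,u,\nabla u)\ \text{ in }\Omega,\qquad u=0\ \text{ on }\partial\Omega$$ admits a viscosity solution over $\Omega$.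
   Context: Definitions (for the equation $\det D^2u=f(x,u,\nabla u)$ over $\Omega$). Let $u\in C(\overline{\Omega})$ be a convex function with $u<0$ in $\Omega$ (so that $f(x,u(x),\cdot)$ is defined). (i) $u$ is a viscosity subsolution over $\Omega$ if for any $x_0\in\Omega$, any open neighborhood $U(x_0)$ of $x_0$ and any convex function $\phi\in C^2(U(x_0)\cap\Omega)$ with $(\phi-u)(x)\geqslant(\phi-u)(x_0)$ for all $x\in U(x_0)\cap\Omega$, one has $\det D^2\phi(x_0)\geqslant f(x_0,u(x_0),\nabla\phi(x_0))$. (ii) $u$ is a viscosity supersolution over $\Omega$ if for any $x_0\in\Omega$, any open neighborhood $U(x_0)$ of $x_0$ and any convex function $\phi\in C^2(U(x_0)\cap\Omega)$ with $(\phi-u)(x)\leqslant(\phi-u)(x_0)$ for all $x\in U(x_0)\cap\Omega$, one has $\det D^2\phi(x_0)\leqslant f(x_0,u(x_0),\nabla\phi(x_0))$. (iii) $u$ is a viscosity solution of the equation over $\Omega$ if it is both a viscosity subsolution and a viscosity supersolution over $\Omega$. (iv) $u$ is a viscosity solution to the Dirichlet problem over $\Omega$ if it is a viscosity solution of the equation over $\Omega$ and $u=0$ on $\partial\Omega$. *)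

theory Defs
  imports "HOL-Analysis.Analysis"
begin

text \<open>
  The gradient and the Hessian are the ones of an open set: at \<open>x\<close> they depend only on the
  values of \<open>\<phi>\<close> near \<open>x\<close>, and they are only meaningful where the respective
  derivative exists (\<open>C2_on\<close> guarantees this).
\<close>

definition gradient :: "(real ^ 'n \<Rightarrow> real) \<Rightarrow> real ^ 'n \<Rightarrow> real ^ 'n" where
  "gradient \<phi> x = (\<chi> i. frechet_derivative \<phi> (at x) (axis i 1))"

definition hessian :: "(real ^ 'n \<Rightarrow> real) \<Rightarrow> real ^ 'n \<Rightarrow> real ^ 'n ^ 'n" where
  "hessian \<phi> x = jacobian (gradient \<phi>) (at x)"

definition C2_on :: "(real ^ 'n) set \<Rightarrow> (real ^ 'n \<Rightarrow> real) \<Rightarrow> bool" where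
  "C2_on S \<phi> \<longleftrightarrow> open S \<and> \<phi> differentiable_on S \<and> gradient \<phi> differentiable_on S \<and>
     continuous_on S (hessian \<phi>)"

text \<open>
  Test functions are convex functions on \<open>U \<inter> \<Omega>\<close> for an arbitrary open \<open>U\<close>, so the domain
  need not be convex, whereas \<open>convex_on S\<close> includes \<open>convex S\<close>. A function on a general set is
  called convex here if it is convex on each convex subset (equivalently, along each segment
  contained in the set).
\<close>

definition convex_fun_on :: "'a::real_vector set \<Rightarrow> ('a \<Rightarrow> real) \<Rightarrow> bool" where
  "convex_fun_on S \<phi> \<longleftrightarrow> (\<forall>C. C \<subseteq> S \<and> convex C \<longrightarrow> convex_on C \<phi>)"

lemma convex_fun_on_iff_convex_on:
  assumes "convex S"
  shows "convex_fun_on S \<phi> \<longleftrightarrow> convex_on S \<phi>"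
  using assms unfolding convex_fun_on_def by (auto intro: convex_on_subset)

definition viscosity_candidate :: "(real ^ 'n) set \<Rightarrow> (real ^ 'n \<Rightarrow> real) \<Rightarrow> bool" where
  "viscosity_candidate \<Omega> u \<longleftrightarrow>
     continuous_on (closure \<Omega>) u \<and> convex_on (closure \<Omega>) u \<and> (\<forall>x\<in>\<Omega>. u x < 0)"

definition viscosity_subsolution ::
  "(real ^ 'n \<Rightarrow> real \<Rightarrow> real ^ 'n \<Rightarrow> real) \<Rightarrow> (real ^ 'n) set \<Rightarrow> (real ^ 'n \<Rightarrow> real) \<Rightarrow> bool" where
  "viscosity_subsolution f \<Omega> u \<longleftrightarrow> viscosity_candidate \<Omega> u \<and>
     (\<forall>x0\<in>\<Omega>. \<forall>U \<phi>. open U \<and> x0 \<in> U \<and> C2_on (U \<inter> \<Omega>) \<phi> \<and> convex_fun_on (U \<inter> \<Omega>) \<phi> \<and>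
        (\<forall>x\<in>U \<inter> \<Omega>. \<phi> x - u x \<ge> \<phi> x0 - u x0) \<longrightarrow>
        det (hessian \<phi> x0) \<ge> f x0 (u x0) (gradient \<phi> x0))"

definition viscosity_supersolution ::
  "(real ^ 'n \<Rightarrow> real \<Rightarrow> real ^ 'n \<Rightarrow> real) \<Rightarrow> (real ^ 'n) set \<Rightarrow> (real ^ 'n \<Rightarrow> real) \<Rightarrow> bool" where
  "viscosity_supersolution f \<Omega> u \<longleftrightarrow> viscosity_candidate \<Omega> u \<and>
     (\<forall>x0\<in>\<Omega>. \<forall>U \<phi>. open U \<and> x0 \<in> U \<and> C2_on (U \<inter> \<Omega>) \<phi> \<and> convex_fun_on (U \<inter> \<Omega>) \<phi> \<and>
        (\<forall>x\<in>U \<inter> \<Omega>. \<phi> x - u x \<le> \<phi> x0 - u x0) \<longrightarrow>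
        det (hessian \<phi> x0) \<le> f x0 (u x0) (gradient \<phi> x0))"

definition viscosity_solution ::
  "(real ^ 'n \<Rightarrow> real \<Rightarrow> real ^ 'n \<Rightarrow> real) \<Rightarrow> (real ^ 'n) set \<Rightarrow> (real ^ 'n \<Rightarrow> real) \<Rightarrow> bool" where
  "viscosity_solution f \<Omega> u \<longleftrightarrow> viscosity_subsolution f \<Omega> u \<and> viscosity_supersolution f \<Omega> u"

definition dirichlet_viscosity_solution ::
  "(real ^ 'n \<Rightarrow> real \<Rightarrow> real ^ 'n \<Rightarrow> real) \<Rightarrow> (real ^ 'n) set \<Rightarrow> (real ^ 'n \<Rightarrow> real) \<Rightarrow> bool" where
  "dirichlet_viscosity_solution f \<Omega> u \<longleftrightarrow>
     viscosity_solution f \<Omega> u \<and> (\<forall>x\<in>frontier \<Omega>. u x = 0)"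

end

theory Submission
  imports Defs
begin

text \<open>
  The solution is the pointwise supremum of all viscosity subsolutions above a fixed constant
  (Perron's method). No comparison principle is needed: the supremum is a subsolution by
  stability, it is a supersolution because it could otherwise be raised near a point, and it is
  negative because all these subsolutions lie below a common small paraboloid on each small ball.

  The boundary values come from barriers. If \<open>y\<close> is a boundary point and \<open>e\<close> the inner normal of a
  supporting hyperplane at \<open>y\<close>, put \<open>T = e \<bullet> (x - y)\<close>, which is at least the distance of \<open>x\<close> to the
  boundary, and \<open>w(x) = K T\<^sup>a (\<bar>x - y\<bar>\<^sup>2 - N)\<close>. For large \<open>N\<close> the Hessian of \<open>w\<close> dominates
  \<open>K (T\<^sup>a I + T\<^bsup>a-2\<^esup> e e\<^sup>t)\<close>, so its determinant is at least \<open>K\<^sup>n T\<^bsup>na-2\<^esup>\<close>, whereas the right-hand side is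
  at most a constant times \<open>K\<^bsup>\<gamma>-\<alpha>\<^esup> T\<^bsup>\<beta>-n-1-a\<alpha>+(a-1)\<gamma>\<^esup>\<close>. The two bounds on \<open>\<gamma>\<close> say that the first dominates
  the second once \<open>a\<close> is small and \<open>K\<close> is large.
\<close>

section \<open>Quadratic forms and determinants\<close>

text \<open>The equation only makes sense for negative values, and a supremum of negative functions
  may vanish. This is why the family has a floor: \<open>f\<close> may tend to 0 as \<open>z\<close>
  decreases, so the opening of the small paraboloid has to be chosen against the value of
  \<open>f\<close> at the floor. The floor must then be shared by the barriers of all boundary
  points, so \<open>a\<close>, \<open>N\<close> and \<open>K\<close> may depend on \<Omega> only
  through a bound \<open>R\<close> for its diameter. As \<open>f\<close> is not controlled where
  \<open>u = 0\<close>, nothing is tested on the boundary: convexity gives continuity inside, and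
  each barrier squeezes the supremum between itself and 0 at its own point. In the barrier,
  \<open>- N T^a\<close> is convex across the hyperplane but flat along it; the factor
  \<open>|x - y|^2\<close> supplies the remaining curvature, and a large \<open>N\<close> absorbs
  the mixed term. The gradient has size \<open>K T^(a-1)\<close>, and the quotient of the right-hand
  side by the determinant bound is of order \<open>K^(-\<kappa>) T^(\<mu> - a \<kappa>)\<close> with
  \<open>\<kappa> = n + \<alpha> - \<gamma>\<close> and
  \<open>\<mu> = \<beta> - n + 1 - \<gamma>\<close>. Thus \<open>\<kappa> > 0\<close> lets a large
  \<open>K\<close> win, and \<open>\<mu> > 0\<close> leaves room for a positive
  \<open>a\<close>.\<close>

lemma linear_term_zero_if_quadratic_nonneg:
  fixes p q :: real
  assumes "\<And>s. 0 \<le> 2 * s * p + s\<^sup>2 * q"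
  shows "p = 0"
proof (rule ccontr)
  assume "p \<noteq> 0"
  \<comment> \<open>The minimizer of the majorant with \<open>\<bar>q\<bar> + 1\<close> in place of
    \<open>q\<close>; the summand 1 keeps the denominator positive.\<close>
  define s where "s = - p / (\<bar>q\<bar> + 1)"
  have "2 * s * p + s\<^sup>2 * q \<le> 2 * s * p + s\<^sup>2 * (\<bar>q\<bar> + 1)"
    by (intro add_left_mono mult_left_mono) auto
  also have "\<dots> = - p\<^sup>2 / (\<bar>q\<bar> + 1)"
  proof -
    have pos: "\<bar>q\<bar> + 1 > 0" by simp
    have "s * (\<bar>q\<bar> + 1) = - p"
      using pos unfolding s_def by simp
    then have "2 * s * p + s\<^sup>2 * (\<bar>q\<bar> + 1) = s * p"
      by (simp add: power2_eq_square mult.assoc)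
    then show ?thesis by (simp add: s_def power2_eq_square)
  qed
  also have "\<dots> < 0"
    using \<open>p \<noteq> 0\<close> by (simp add: divide_neg_pos)
  finally show False
    using assms[of s] by simp
qed

lemma inner_matrix_vector_transpose:
  fixes A :: "real^'n^'n"
  shows "x \<bullet> (A *v y) = (transpose A *v x) \<bullet> y"
  by (metis dot_lmul_matrix vector_transpose_matrix transpose_transpose)

lemma symmetric_matrix_inner_commute:
  fixes A :: "real^'n^'n"
  assumes "transpose A = A"
  shows "x \<bullet> (A *v y) = y \<bullet> (A *v x)"
  using inner_matrix_vector_transpose[of x A y] assms by (simp add: inner_commute)

lemma quadratic_form_add:
  fixes A :: "real^'n^'n"
  assumes "transpose A = A"
  shows "(x + s *\<^sub>R w) \<bullet> (A *v (x + s *\<^sub>R w))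
    = x \<bullet> (A *v x) + 2 * s * (w \<bullet> (A *v x)) + s\<^sup>2 * (w \<bullet> (A *v w))"
  using symmetric_matrix_inner_commute[OF assms, of x w]
  by (simp add: matrix_vector_right_distrib matrix_vector_mult_scaleR algebra_simps
      inner_add_left inner_add_right power2_eq_square)

text \<open>A zero of a nonnegative quadratic form is a minimum, so the first variation vanishes
  there and the vector lies in the kernel of \<open>A\<close>, which is trivial.\<close>

lemma psd_det_nonzero_imp_pd:
  fixes A :: "real^'n^'n"
  assumes sym: "transpose A = A" and psd: "\<And>x. 0 \<le> x \<bullet> (A *v x)" and "det A \<noteq> 0" and "x \<noteq> 0"
  shows "0 < x \<bullet> (A *v x)"
proof (rule ccontr)
  assume "\<not> 0 < x \<bullet> (A *v x)"
  then have x0: "x \<bullet> (A *v x) = 0"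
    using psd[of x] by simp
  have "w \<bullet> (A *v x) = 0" for w
  proof (rule linear_term_zero_if_quadratic_nonneg[of _ "w \<bullet> (A *v w)"])
    show "0 \<le> 2 * s * (w \<bullet> (A *v x)) + s\<^sup>2 * (w \<bullet> (A *v w))" for s
      using psd[of "x + s *\<^sub>R w"] x0 by (simp add: quadratic_form_add[OF sym])
  qed
  then have "A *v x = 0"
    by (metis inner_eq_zero_iff)
  then show False
    using assms(3,4) by (metis invertible_det_nz matrix_left_invertible_ker invertible_left_inverse)
qed

text \<open>Induction over the columns: the next one maximizes the Rayleigh quotient on the
  \<open>B\<close>-orthogonal complement of the columns found so far.\<close>

lemma generalized_eigenvectors:
  fixes A B :: "real^'n^'n" and J :: "'n set"
  assumes symA: "transpose A = A" and symB: "transpose B = B"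
    and pd: "\<And>x. x \<noteq> 0 \<Longrightarrow> 0 < x \<bullet> (B *v x)"
  shows "\<exists>v d. (\<forall>i\<in>J. \<forall>j\<in>J. v i \<bullet> (B *v v j) = (if i = j then 1 else 0)) \<and>
      (\<forall>i\<in>J. \<forall>w. w \<bullet> (A *v v i) = d i * (w \<bullet> (B *v v i)))"
proof -
  have "finite J" by (rule finite)
  then show ?thesis
  proof (induction J rule: finite_induct)
    case empty
    then show ?case by simp
  next
    case (insert k J)
    then obtain v d where orth: "\<And>i j. i \<in> J \<Longrightarrow> j \<in> J \<Longrightarrow> v i \<bullet> (B *v v j) = (if i = j then 1 else 0)"
      and eig: "\<And>i w. i \<in> J \<Longrightarrow> w \<bullet> (A *v v i) = d i * (w \<bullet> (B *v v i))"
      by blast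
    define V where "V = {x. \<forall>i\<in>J. x \<bullet> (B *v v i) = 0}"
    have V_add: "x + s *\<^sub>R y \<in> V" if "x \<in> V" "y \<in> V" for x y s
      using that by (simp add: V_def inner_add_left)
    have V_scale: "s *\<^sub>R x \<in> V" if "x \<in> V" for x s
      using that by (simp add: V_def)
    have "closed V"
    proof -
      have "V = (\<Inter>i\<in>J. {x. x \<bullet> (B *v v i) = 0})" by (auto simp: V_def)
      then show ?thesis
        by (auto intro!: closed_INT closed_Collect_eq continuous_intros)
    qed
    \<comment> \<open>Dimension count: the kernel of \<open>L\<close> is \<open>V\<close>. As
      \<open>k\<close> is not in \<open>J\<close>, coordinate \<open>k\<close> of \<open>L x\<close>
      is always 0, so \<open>L\<close> is not surjective, hence not injective, and \<open>V\<close>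
      contains a nonzero vector.\<close>
    define L where "L x = (\<chi> i. if i \<in> J then x \<bullet> (B *v v i) else 0)" for x
    have "linear L"
      by (rule linearI) (auto simp: L_def vec_eq_iff inner_add_left)
    have "\<not> inj L"
    proof
      assume "inj L"
      then have "surj L"
        using linear_injective_imp_surjective[OF \<open>linear L\<close>] by simp
      then obtain x where "L x = axis k 1"
        by (metis surjD)
      then have "L x $ k = 1" by simp
      then show False
        using insert.hyps(2) by (simp add: L_def)
    qed
    then obtain z where "z \<noteq> 0" "L z = 0"
      using \<open>linear L\<close> linear_injective_0 by blast
    have "z \<bullet> (B *v v i) = 0" if "i \<in> J" for i
      using that arg_cong[OF \<open>L z = 0\<close>, of "\<lambda>u. u $ i"] by (simp add: L_def)
    then have "z \<in> V"
      by (simp add: V_def)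
    define K where "K = V \<inter> sphere 0 1"
    have "compact K"
      unfolding K_def using \<open>closed V\<close> by (intro closed_Int_compact) auto
    moreover have "(1 / norm z) *\<^sub>R z \<in> K"
      using \<open>z \<noteq> 0\<close> \<open>z \<in> V\<close> V_scale by (simp add: K_def)
    moreover have "continuous_on K (\<lambda>x. (x \<bullet> (A *v x)) / (x \<bullet> (B *v x)))"
    proof -
      have "x \<bullet> (B *v x) \<noteq> 0" if "x \<in> K" for x
        using pd[of x] that unfolding K_def by force
      then show ?thesis
        by (intro continuous_intros linear_continuous_on matrix_vector_mul_bounded_linear) auto
    qed
    ultimately obtain x where "x \<in> K"
      and max: "\<And>y. y \<in> K \<Longrightarrow> (y \<bullet> (A *v y)) / (y \<bullet> (B *v y)) \<le> (x \<bullet> (A *v x)) / (x \<bullet> (B *v x))"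
      using continuous_attains_sup[of K "\<lambda>x. (x \<bullet> (A *v x)) / (x \<bullet> (B *v x))"] by blast
    then have "x \<in> V" "x \<noteq> 0"
      by (auto simp: K_def)
    define c where "c = (x \<bullet> (A *v x)) / (x \<bullet> (B *v x))"
    have Bx: "0 < x \<bullet> (B *v x)"
      using pd \<open>x \<noteq> 0\<close> by blast
    have Ax: "x \<bullet> (A *v x) = c * (x \<bullet> (B *v x))"
      using Bx by (simp add: c_def)
    have le: "w \<bullet> (A *v w) \<le> c * (w \<bullet> (B *v w))" if "w \<in> V" for w
    proof (cases "w = 0")
      case False
      define y where "y = (1 / norm w) *\<^sub>R w"
      have "y \<in> K"
        using False that V_scale by (simp add: K_def y_def)
      from max[OF this] have "(w \<bullet> (A *v w)) / (w \<bullet> (B *v w)) \<le> c"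
        using False by (simp add: y_def matrix_vector_mult_scaleR c_def)
      then show ?thesis
        using pd[OF False] by (simp add: pos_divide_le_eq)
    qed simp
    \<comment> \<open>First variation at the maximizer, with perturbations inside
      \<open>V\<close>.\<close>
    have eigV: "w \<bullet> (A *v x) = c * (w \<bullet> (B *v x))" if "w \<in> V" for w
    proof -
      have "c * (w \<bullet> (B *v x)) - w \<bullet> (A *v x) = 0"
      proof (rule linear_term_zero_if_quadratic_nonneg[of _ "c * (w \<bullet> (B *v w)) - w \<bullet> (A *v w)"])
        fix s
        show "0 \<le> 2 * s * (c * (w \<bullet> (B *v x)) - w \<bullet> (A *v x))
            + s\<^sup>2 * (c * (w \<bullet> (B *v w)) - w \<bullet> (A *v w))"
          using le[OF V_add[OF \<open>x \<in> V\<close> that, of s]] Ax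
          unfolding quadratic_form_add[OF symA] quadratic_form_add[OF symB]
          by (simp add: algebra_simps)
      qed
      then show ?thesis by simp
    qed
    have xB: "v i \<bullet> (B *v x) = 0" "x \<bullet> (B *v v i) = 0" if "i \<in> J" for i
      using \<open>x \<in> V\<close> that symmetric_matrix_inner_commute[OF symB, of x "v i"] by (auto simp: V_def)
    have xA: "v i \<bullet> (A *v x) = 0" if "i \<in> J" for i
      using eig[OF that, of x] xB[OF that] symmetric_matrix_inner_commute[OF symA, of x "v i"] by simp
    have eigx: "w \<bullet> (A *v x) = c * (w \<bullet> (B *v x))" for w
    proof -
      \<comment> \<open>The \<open>B\<close>-projection of \<open>w\<close> to the earlier columns:
        \<open>w - p\<close> lies in \<open>V\<close>, and both sides vanish on those columns, so
        the identity extends from \<open>V\<close> to all vectors.\<close>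
      define p where "p = (\<Sum>i\<in>J. (w \<bullet> (B *v v i)) *\<^sub>R v i)"
      have "p \<bullet> (B *v v j) = w \<bullet> (B *v v j)" if "j \<in> J" for j
      proof -
        have "p \<bullet> (B *v v j) = (\<Sum>i\<in>J. (w \<bullet> (B *v v i)) * (if i = j then 1 else 0))"
          unfolding p_def inner_sum_left using orth that by (intro sum.cong) auto
        then show ?thesis
          using that insert.hyps(1) by (simp add: if_distrib sum.delta cong: if_cong)
      qed
      then have "w - p \<in> V"
        by (simp add: V_def inner_diff_left)
      from eigV[OF this] show ?thesis
        unfolding p_def by (simp add: inner_diff_left inner_sum_left xA xB)
    qed
    define e where "e = (1 / sqrt (x \<bullet> (B *v x))) *\<^sub>R x"
    have "e \<bullet> (B *v e) = 1"
      using Bx by (simp add: e_def matrix_vector_mult_scaleR field_simps)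
    moreover have "v i \<bullet> (B *v e) = 0" "e \<bullet> (B *v v i) = 0" if "i \<in> J" for i
      using xB[OF that] by (simp_all add: e_def matrix_vector_mult_scaleR)
    moreover have "w \<bullet> (A *v e) = c * (w \<bullet> (B *v e))" for w
      using eigx[of w] by (simp add: e_def matrix_vector_mult_scaleR)
    ultimately have "(\<forall>i\<in>insert k J. \<forall>j\<in>insert k J.
          (v(k := e)) i \<bullet> (B *v (v(k := e)) j) = (if i = j then 1 else 0)) \<and>
        (\<forall>i\<in>insert k J. \<forall>w. w \<bullet> (A *v (v(k := e)) i) = (d(k := c)) i * (w \<bullet> (B *v (v(k := e)) i)))"
      using orth eig insert.hyps(2) by (auto simp: fun_upd_apply)
    then show ?case by blast
  qed
qed

lemma transpose_mult_component:
  fixes A S :: "real^'n^'n"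
  shows "(transpose S ** A ** S) $ i $ j = column i S \<bullet> (A *v column j S)"
proof -
  have "(transpose S ** A ** S) $ i $ j = axis i 1 \<bullet> ((transpose S ** A ** S) *v axis j 1)"
    by (simp add: matrix_vector_mult_basis column_def inner_axis')
  also have "\<dots> = axis i 1 \<bullet> (transpose S *v (A *v (S *v axis j 1)))"
    by (simp only: matrix_vector_mul_assoc matrix_mul_assoc)
  also have "\<dots> = (S *v axis i 1) \<bullet> (A *v (S *v axis j 1))"
    by (simp only: inner_matrix_vector_transpose[of "axis i 1" "transpose S"] transpose_transpose)
  finally show ?thesis
    by (simp add: matrix_vector_mult_basis)
qed

text \<open>Congruence by the \<open>B\<close>-orthonormal generalized eigenvectors turns
  \<open>B\<close> into the identity and \<open>A\<close> into a diagonal matrix with entries at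
  least 1; both determinants are scaled by the same positive square.\<close>

lemma det_mono_pd:
  fixes A B :: "real^'n^'n"
  assumes symA: "transpose A = A" and symB: "transpose B = B"
    and pd: "\<And>x. x \<noteq> 0 \<Longrightarrow> 0 < x \<bullet> (B *v x)"
    and le: "\<And>x. x \<bullet> (B *v x) \<le> x \<bullet> (A *v x)"
  shows "det B \<le> det A"
proof -
  obtain v d where orth: "\<And>i j::'n. v i \<bullet> (B *v v j) = (if i = j then 1 else 0)"
    and eig: "\<And>i w. w \<bullet> (A *v v i) = d i * (w \<bullet> (B *v v i))"
    using generalized_eigenvectors[OF symA symB pd, of UNIV] by auto
  define S :: "real^'n^'n" where "S = (\<chi> i j. v j $ i)"
  have col: "column j S = v j" for j
    by (simp add: S_def column_def vec_eq_iff)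
  have "transpose S ** B ** S = mat 1"
    by (simp add: vec_eq_iff transpose_mult_component col orth mat_def)
  from arg_cong[OF this, of det] have B: "(det S)\<^sup>2 * det B = 1"
    by (simp add: det_mul det_transpose power2_eq_square ac_simps)
  have "det (transpose S ** A ** S) = (\<Prod>i\<in>UNIV. (transpose S ** A ** S) $ i $ i)"
    by (rule det_diagonal) (simp add: transpose_mult_component col eig orth)
  also have "\<dots> = prod d UNIV"
    by (simp add: transpose_mult_component col eig orth)
  finally have A: "(det S)\<^sup>2 * det A = prod d UNIV"
    by (simp add: det_mul det_transpose power2_eq_square ac_simps)
  have "1 \<le> d i" for i
    using le[of "v i"] eig[of "v i" i] orth[of i i] by simp
  then have "1 \<le> prod d UNIV"
    by (intro prod_ge_1) auto
  then have "(det S)\<^sup>2 * det B \<le> (det S)\<^sup>2 * det A"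
    using A B by simp
  moreover have "0 < (det S)\<^sup>2"
    using B by (metis mult_zero_left zero_less_power2 zero_neq_one zero_power2)
  ultimately show ?thesis
    by simp
qed

text \<open>An orthogonal change of basis takes \<open>e\<close> to a coordinate axis and makes the
  form on the left diagonal, with determinant \<open>(l + m) * l ^ (CARD('n) - 1)\<close>; dropping
  \<open>l\<close> from the first factor gives the bound.\<close>

lemma det_ge_rank_one_perturbation:
  fixes A :: "real^'n^'n"
  assumes sym: "transpose A = A" and "norm e = 1" and "0 < l" "0 \<le> m"
    and le: "\<And>x. l * (x \<bullet> x) + m * (e \<bullet> x)\<^sup>2 \<le> x \<bullet> (A *v x)"
  shows "m * l ^ (CARD('n) - 1) \<le> det A"
proof -
  define k :: 'n where "k = undefined"
  obtain R :: "real^'n^'n" where R: "orthogonal_matrix R" "R *v axis k 1 = e"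
    using orthogonal_matrix_exists_basis[OF \<open>norm e = 1\<close>] by metis
  have RR: "transpose R ** R = mat 1"
    using R(1) by (auto simp: orthogonal_matrix_def)
  define D :: "real^'n^'n" where "D = (\<chi> i j. if i = j then (if i = k then l + m else l) else 0)"
  have D: "x \<bullet> (D *v x) = l * (x \<bullet> x) + m * (x $ k)\<^sup>2" for x
  proof -
    have "(D *v x) $ i = (if i = k then l + m else l) * x $ i" for i
    proof -
      have "(D *v x) $ i = (\<Sum>j\<in>UNIV. if i = j then (if i = k then l + m else l) * x $ j else 0)"
        unfolding D_def matrix_vector_mult_def vec_lambda_beta by (intro sum.cong) simp_all
      then show ?thesis by simp
    qed
    then have "x \<bullet> (D *v x) = (\<Sum>i\<in>UNIV. (if i = k then m * (x $ i)\<^sup>2 else 0) + l * (x $ i)\<^sup>2)"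
      unfolding inner_vec_def by (intro sum.cong) (auto simp: algebra_simps power2_eq_square)
    also have "\<dots> = l * (x \<bullet> x) + m * (x $ k)\<^sup>2"
      by (simp add: sum.distrib sum.delta inner_vec_def power2_eq_square flip: sum_distrib_left)
    finally show ?thesis .
  qed
  have "det D \<le> det (transpose R ** A ** R)"
  proof (rule det_mono_pd)
    show "transpose (transpose R ** A ** R) = transpose R ** A ** R"
      by (simp add: matrix_transpose_mul sym matrix_mul_assoc)
    show "transpose D = D"
      by (auto simp: transpose_def D_def vec_eq_iff)
    show "0 < x \<bullet> (D *v x)" if "x \<noteq> 0" for x
      using that \<open>0 < l\<close> \<open>0 \<le> m\<close> by (simp add: D add_pos_nonneg)
    show "x \<bullet> (D *v x) \<le> x \<bullet> ((transpose R ** A ** R) *v x)" for x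
    proof -
      have "x \<bullet> ((transpose R ** A ** R) *v x) = x \<bullet> (transpose R *v (A *v (R *v x)))"
        by (simp only: matrix_vector_mul_assoc matrix_mul_assoc)
      also have "\<dots> = (R *v x) \<bullet> (A *v (R *v x))"
        by (simp only: inner_matrix_vector_transpose[of x "transpose R"] transpose_transpose)
      finally have "x \<bullet> ((transpose R ** A ** R) *v x) = (R *v x) \<bullet> (A *v (R *v x))" .
      moreover have "(R *v x) \<bullet> (R *v y) = x \<bullet> y" for x y
        by (simp only: inner_matrix_vector_transpose[of "R *v x" R y] matrix_vector_mul_assoc RR
            matrix_vector_mul_lid)
      moreover from this[of "axis k 1" x] have "e \<bullet> (R *v x) = x $ k"
        by (simp add: R(2) inner_axis')
      ultimately show ?thesis
        using le[of "R *v x"] by (simp add: D)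
    qed
  qed
  also have "det (transpose R ** A ** R) = det A"
    using arg_cong[OF RR, of det] by (simp add: det_mul mult.assoc mult.left_commute)
  finally have "det D \<le> det A" .
  moreover have "det D = (l + m) * l ^ (CARD('n) - 1)"
  proof -
    have "det D = (\<Prod>i\<in>UNIV. D $ i $ i)"
      by (rule det_diagonal) (simp add: D_def)
    also have "\<dots> = (\<Prod>i\<in>UNIV. if i = k then l + m else l)"
      by (simp add: D_def)
    also have "\<dots> = (l + m) * (\<Prod>i\<in>UNIV - {k}. l)"
      by (subst prod.remove[of _ k]) (auto intro!: prod.cong)
    finally show ?thesis by (simp add: card_Diff_singleton)
  qed
  moreover have "m * l ^ (CARD('n) - 1) \<le> (l + m) * l ^ (CARD('n) - 1)"
    using \<open>0 < l\<close> by (intro mult_right_mono) auto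
  ultimately show ?thesis by simp
qed

section \<open>Second derivatives\<close>

lemma gradient_eqI:
  assumes "(\<phi> has_derivative (\<lambda>h. g \<bullet> h)) (at x)"
  shows "gradient \<phi> x = g"
  using frechet_derivative_at[OF assms, symmetric]
  by (simp add: gradient_def vec_eq_iff inner_axis)

lemma hessian_eqI:
  assumes "(gradient \<phi> has_derivative (\<lambda>h. H *v h)) (at x)"
  shows "hessian \<phi> x = H"
  using frechet_derivative_at[OF assms, symmetric]
  by (simp add: hessian_def jacobian_def)

lemma has_derivative_gradient:
  fixes \<phi> :: "real^'n \<Rightarrow> real"
  assumes "\<phi> differentiable (at x)"
  shows "(\<phi> has_derivative (\<lambda>h. gradient \<phi> x \<bullet> h)) (at x)"
proof -
  let ?D = "frechet_derivative \<phi> (at x)"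
  have D: "(\<phi> has_derivative ?D) (at x)"
    using assms by (simp add: frechet_derivative_works)
  interpret D: linear ?D
    using assms by (rule linear_frechet_derivative)
  have "?D h = gradient \<phi> x \<bullet> h" for h
  proof -
    have "?D h = ?D (\<Sum>i\<in>UNIV. (h $ i) *\<^sub>R axis i 1)"
      using basis_expansion[of h] by (simp add: scalar_mult_eq_scaleR)
    also have "\<dots> = gradient \<phi> x \<bullet> h"
      by (simp add: D.sum D.scale gradient_def inner_vec_def mult.commute)
    finally show ?thesis .
  qed
  then have "?D = (\<lambda>h. gradient \<phi> x \<bullet> h)"
    by (rule ext)
  with D show ?thesis
    by simp
qed

lemma C2_onD:
  assumes "C2_on S \<phi>" "x \<in> S"
  shows "(\<phi> has_derivative (\<lambda>h. gradient \<phi> x \<bullet> h)) (at x)"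
    and "(gradient \<phi> has_derivative (\<lambda>h. hessian \<phi> x *v h)) (at x)"
proof -
  have "\<phi> differentiable (at x)" "gradient \<phi> differentiable (at x)"
    using assms by (auto simp: C2_on_def differentiable_on_eq_differentiable_at)
  then show "(\<phi> has_derivative (\<lambda>h. gradient \<phi> x \<bullet> h)) (at x)"
    "(gradient \<phi> has_derivative (\<lambda>h. hessian \<phi> x *v h)) (at x)"
    unfolding hessian_def by (auto simp: has_derivative_gradient jacobian_works)
qed

lemma C2_on_subset:
  assumes "C2_on S \<phi>" "T \<subseteq> S" "open T"
  shows "C2_on T \<phi>"
  using assms unfolding C2_on_def
  by (meson continuous_on_subset differentiable_on_subset)

lemma C2_on_continuous:
  assumes "C2_on S \<phi>"
  shows "continuous_on S \<phi>" "continuous_on S (gradient \<phi>)" "continuous_on S (hessian \<phi>)"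
  using assms unfolding C2_on_def
  by (auto intro: differentiable_imp_continuous_on)

lemma has_real_derivative_line:
  fixes \<phi> :: "real^'n \<Rightarrow> real"
  assumes "(\<phi> has_derivative (\<lambda>h. g \<bullet> h)) (at (x + s *\<^sub>R \<xi>))"
  shows "((\<lambda>s. \<phi> (x + s *\<^sub>R \<xi>)) has_real_derivative g \<bullet> \<xi>) (at s)"
proof -
  have "((\<lambda>s. x + s *\<^sub>R \<xi>) has_derivative (\<lambda>h. h *\<^sub>R \<xi>)) (at s)"
    by (auto intro!: derivative_eq_intros)
  from has_derivative_compose[OF this assms]
  have "((\<lambda>s. \<phi> (x + s *\<^sub>R \<xi>)) has_derivative (\<lambda>h. g \<bullet> (h *\<^sub>R \<xi>))) (at s)" .
  then show ?thesis
    by (simp add: has_field_derivative_def mult_commute_abs)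
qed

lemma has_real_derivative_line_gradient:
  fixes \<phi> :: "real^'n \<Rightarrow> real"
  assumes "C2_on S \<phi>" "x + s *\<^sub>R \<xi> \<in> S"
  shows "((\<lambda>s. \<phi> (x + s *\<^sub>R \<xi>)) has_real_derivative gradient \<phi> (x + s *\<^sub>R \<xi>) \<bullet> \<xi>) (at s)"
  by (intro has_real_derivative_line C2_onD(1)[OF assms])

lemma has_real_derivative_line_hessian:
  fixes \<phi> :: "real^'n \<Rightarrow> real"
  assumes "C2_on S \<phi>" "x + s *\<^sub>R \<xi> \<in> S"
  shows "((\<lambda>s. gradient \<phi> (x + s *\<^sub>R \<xi>) \<bullet> \<zeta>) has_real_derivative
    \<zeta> \<bullet> (hessian \<phi> (x + s *\<^sub>R \<xi>) *v \<xi>)) (at s)"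
proof -
  have "((\<lambda>s. x + s *\<^sub>R \<xi>) has_derivative (\<lambda>h. h *\<^sub>R \<xi>)) (at s)"
    by (auto intro!: derivative_eq_intros)
  from has_derivative_compose[OF this C2_onD(2)[OF assms]]
  have "((\<lambda>s. gradient \<phi> (x + s *\<^sub>R \<xi>)) has_derivative
      (\<lambda>h. hessian \<phi> (x + s *\<^sub>R \<xi>) *v (h *\<^sub>R \<xi>))) (at s)" .
  from has_derivative_inner_left[OF this, of \<zeta>] show ?thesis
    by (simp add: has_field_derivative_def matrix_vector_mult_scaleR inner_commute
        mult_commute_abs)
qed

section \<open>Second derivative test and symmetry of the Hessian\<close>

lemma second_derivative_test_local_min:
  fixes g g' :: "real \<Rightarrow> real"
  assumes "0 < d" and deriv: "\<And>s. \<bar>s\<bar> < d \<Longrightarrow> (g has_real_derivative g' s) (at s)"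
    and deriv2: "(g' has_real_derivative c) (at 0)"
    and min: "\<And>s. \<bar>s\<bar> < d \<Longrightarrow> g 0 \<le> g s"
  shows "g' 0 = 0" "0 \<le> c"
proof -
  show g'0: "g' 0 = 0"
    using DERIV_local_min[of g "g' 0" 0 d] deriv[of 0] \<open>0 < d\<close> min by simp
  show "0 \<le> c"
  proof (rule ccontr)
    assume "\<not> 0 \<le> c"
    with DERIV_neg_dec_right[OF deriv2] obtain r where r: "0 < r" "\<And>h. 0 < h \<Longrightarrow> h < r \<Longrightarrow> g' h < 0"
      using g'0 by force
    define s where "s = min r d / 2"
    have s: "0 < s" "s < r" "s < d"
      using r(1) \<open>0 < d\<close> by (auto simp: s_def)
    have "g s < g 0"
    proof (rule DERIV_neg_imp_decreasing_open[OF s(1)])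
      show "\<exists>y. (g has_real_derivative y) (at x) \<and> y < 0" if "0 < x" "x < s" for x
        using deriv[of x] r(2)[of x] that s by auto
      show "continuous_on {0..s} g"
        using s deriv by (intro continuous_at_imp_continuous_on ballI) (auto intro!: DERIV_isCont[OF deriv])
    qed
    then show False
      using min[of s] s by simp
  qed
qed

text \<open>The second difference is symmetric in \<open>u\<close> and \<open>v\<close>, which will
  force the Hessian to be symmetric. The mean value theorem in direction \<open>v\<close>, applied
  to the difference in direction \<open>u\<close>, leaves a difference of gradients, which is
  linearized at \<open>x\<close>.\<close>

lemma second_difference_estimate:
  fixes \<phi> :: "real^'n \<Rightarrow> real"
  assumes C2: "C2_on S \<phi>" and "x \<in> S" and "0 < \<epsilon>"
  shows "\<exists>r>0. \<forall>s. 0 < s \<and> s < r \<longrightarrow>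
    \<bar>\<phi> (x + s *\<^sub>R u + s *\<^sub>R v) - \<phi> (x + s *\<^sub>R u) - \<phi> (x + s *\<^sub>R v) + \<phi> x
      - s\<^sup>2 * (v \<bullet> (hessian \<phi> x *v u))\<bar> \<le> \<epsilon> * s\<^sup>2"
proof -
  define N where "N = norm u + norm v + 1"
  have N: "0 < N" "norm u + norm v \<le> N" "norm v \<le> N"
    by (auto simp: N_def add_nonneg_pos)
  \<comment> \<open>The two gradient errors contribute at most
    \<open>s * (2 * (\<eta> * (s * N)) * N)\<close>; this \<eta> makes that
    \<open>\<epsilon> * s\<^sup>2\<close>.\<close>
  define \<eta> where "\<eta> = \<epsilon> / (2 * N * N)"
  have "0 < \<eta>"
    using N \<open>0 < \<epsilon>\<close> by (simp add: \<eta>_def)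
  obtain d where d: "0 < d" "\<And>y. norm (y - x) < d \<Longrightarrow>
      norm (gradient \<phi> y - gradient \<phi> x - hessian \<phi> x *v (y - x)) \<le> \<eta> * norm (y - x)"
    using C2_onD(2)[OF C2 \<open>x \<in> S\<close>] \<open>0 < \<eta>\<close> unfolding has_derivative_at_alt by blast
  obtain d' where d': "0 < d'" "ball x d' \<subseteq> S"
    using C2 \<open>x \<in> S\<close> by (meson C2_on_def openE)
  show ?thesis
  proof (intro exI conjI allI impI)
    show "0 < min d d' / N"
      using N d(1) d'(1) by simp
    fix s assume s: "0 < s \<and> s < min d d' / N"
    then have sN: "s * N < d" "s * N < d'"
      using N(1) by (auto simp: pos_less_divide_eq)
    have small: "norm (a *\<^sub>R u + b *\<^sub>R v) \<le> s * N" if "0 \<le> a" "a \<le> s" "0 \<le> b" "b \<le> s" for a b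
    proof -
      have "norm (a *\<^sub>R u + b *\<^sub>R v) \<le> a * norm u + b * norm v"
        using that norm_triangle_ineq[of "a *\<^sub>R u" "b *\<^sub>R v"] by simp
      also have "\<dots> \<le> s * norm u + s * norm v"
        using that by (intro add_mono mult_right_mono) auto
      also have "\<dots> \<le> s * N"
        using s N(2) by (simp flip: distrib_left)
      finally show ?thesis .
    qed
    have inS: "x + a *\<^sub>R u + b *\<^sub>R v \<in> S" if "0 \<le> a" "a \<le> s" "0 \<le> b" "b \<le> s" for a b
    proof -
      have "x + (a *\<^sub>R u + b *\<^sub>R v) \<in> ball x d'"
        using small[OF that] sN(2) norm_minus_cancel[of "a *\<^sub>R u + b *\<^sub>R v"]
        by (simp add: dist_norm del: norm_minus_cancel)
      then show ?thesis
        using d'(2) by (auto simp: add.assoc)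
    qed
    define g where "g t = \<phi> (x + s *\<^sub>R u + t *\<^sub>R v) - \<phi> (x + t *\<^sub>R v)" for t
    define g' where "g' t = (gradient \<phi> (x + s *\<^sub>R u + t *\<^sub>R v) - gradient \<phi> (x + t *\<^sub>R v)) \<bullet> v" for t
    have "(g has_real_derivative g' t) (at t)" if "0 \<le> t" "t \<le> s" for t
      unfolding g_def g'_def inner_diff_left
      using inS[of s t] inS[of 0 t] that s
      by (intro DERIV_diff has_real_derivative_line_gradient[OF C2]) auto
    then obtain t where t: "0 < t" "t < s" "g s - g 0 = (s - 0) * g' t"
      using MVT2[of 0 s g g'] s by auto
    \<comment> \<open>Error of the linearized gradient; in \<open>E s - E 0\<close> the Hessian
      terms in \<open>v\<close> cancel and only the one in \<open>u\<close> remains.\<close>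
    define E where "E a = gradient \<phi> (x + a *\<^sub>R u + t *\<^sub>R v) - gradient \<phi> x
        - hessian \<phi> x *v (a *\<^sub>R u + t *\<^sub>R v)" for a
    have E: "norm (E a) \<le> \<eta> * (s * N)" if "0 \<le> a" "a \<le> s" for a
    proof -
      have *: "norm (a *\<^sub>R u + t *\<^sub>R v) \<le> s * N"
        using small[of a t] that t by simp
      have "norm (E a) \<le> \<eta> * norm (a *\<^sub>R u + t *\<^sub>R v)"
        using d(2)[of "x + (a *\<^sub>R u + t *\<^sub>R v)"] * sN(1) by (simp add: E_def add.assoc)
      also have "\<dots> \<le> \<eta> * (s * N)"
        using * \<open>0 < \<eta>\<close> by simp
      finally show ?thesis .
    qed
    have g't: "g' t = s * (v \<bullet> (hessian \<phi> x *v u)) + (E s - E 0) \<bullet> v"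
    proof -
      have "E s - E 0 = gradient \<phi> (x + s *\<^sub>R u + t *\<^sub>R v) - gradient \<phi> (x + t *\<^sub>R v)
          - s *\<^sub>R (hessian \<phi> x *v u)"
        by (simp add: E_def matrix_vector_right_distrib matrix_vector_mult_scaleR)
      then show ?thesis
        by (simp add: g'_def inner_diff_left inner_commute[of v])
    qed
    have "g s - g 0 - s\<^sup>2 * (v \<bullet> (hessian \<phi> x *v u)) = s * ((E s - E 0) \<bullet> v)"
      unfolding t(3) g't by (simp add: distrib_left power2_eq_square)
    also have "\<bar>\<dots>\<bar> \<le> s * (2 * (\<eta> * (s * N)) * N)"
    proof -
      have "\<bar>(E s - E 0) \<bullet> v\<bar> \<le> norm (E s - E 0) * norm v"
        by (rule Cauchy_Schwarz_ineq2)
      also have "\<dots> \<le> (2 * (\<eta> * (s * N))) * N"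
        using E[of s] E[of 0] norm_triangle_ineq4[of "E s" "E 0"] s N \<open>0 < \<eta>\<close>
        by (intro mult_mono) auto
      finally show ?thesis
        using s by (simp add: abs_mult)
    qed
    also have "\<dots> = \<epsilon> * s\<^sup>2"
      using N(1) by (simp add: \<eta>_def power2_eq_square field_simps)
    finally show "\<bar>\<phi> (x + s *\<^sub>R u + s *\<^sub>R v) - \<phi> (x + s *\<^sub>R u) - \<phi> (x + s *\<^sub>R v) + \<phi> x
      - s\<^sup>2 * (v \<bullet> (hessian \<phi> x *v u))\<bar> \<le> \<epsilon> * s\<^sup>2"
      by (simp add: g_def algebra_simps)
  qed
qed

text \<open>Exchanging \<open>u\<close> and \<open>v\<close> does not change the second difference,
  so after division by \<open>s\<^sup>2\<close> the two bilinear values differ by an arbitrarily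
  small amount.\<close>

lemma hessian_symmetric:
  fixes \<phi> :: "real^'n \<Rightarrow> real"
  assumes C2: "C2_on S \<phi>" and "x \<in> S"
  shows "transpose (hessian \<phi> x) = hessian \<phi> x"
proof -
  have swap: "v \<bullet> (hessian \<phi> x *v u) \<le> u \<bullet> (hessian \<phi> x *v v)" for u v
  proof (rule field_le_epsilon)
    fix e :: real assume "0 < e"
    then have "0 < e / 2" by simp
    let ?P = "\<lambda>u v s. \<bar>\<phi> (x + s *\<^sub>R u + s *\<^sub>R v) - \<phi> (x + s *\<^sub>R u) - \<phi> (x + s *\<^sub>R v) + \<phi> x
      - s\<^sup>2 * (v \<bullet> (hessian \<phi> x *v u))\<bar> \<le> e / 2 * s\<^sup>2"
    obtain r where r: "0 < r" "\<And>s. 0 < s \<Longrightarrow> s < r \<Longrightarrow> ?P u v s"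
      using second_difference_estimate[OF assms \<open>0 < e / 2\<close>, of u v] by blast
    obtain r' where r': "0 < r'" "\<And>s. 0 < s \<Longrightarrow> s < r' \<Longrightarrow> ?P v u s"
      using second_difference_estimate[OF assms \<open>0 < e / 2\<close>, of v u] by blast
    define s where "s = min r r' / 2"
    have s: "0 < s" "s < r" "s < r'"
      using r(1) r'(1) by (auto simp: s_def)
    have "s\<^sup>2 * (v \<bullet> (hessian \<phi> x *v u)) \<le> s\<^sup>2 * (u \<bullet> (hessian \<phi> x *v v)) + e * s\<^sup>2"
      using r(2)[OF s(1,2)] r'(2)[OF s(1,3)]
      unfolding add.assoc[of x] add.commute[of "s *\<^sub>R v" "s *\<^sub>R u"] by argo
    then have "s\<^sup>2 * (v \<bullet> (hessian \<phi> x *v u)) \<le> s\<^sup>2 * (u \<bullet> (hessian \<phi> x *v v) + e)"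
      by (simp add: algebra_simps)
    then show "v \<bullet> (hessian \<phi> x *v u) \<le> u \<bullet> (hessian \<phi> x *v v) + e"
      using s(1) by simp
  qed
  have "v \<bullet> (hessian \<phi> x *v u) = u \<bullet> (hessian \<phi> x *v v)" for u v
    using swap[of u v] swap[of v u] by simp
  from this[of "axis _ 1" "axis _ 1"] show ?thesis
    by (simp add: vec_eq_iff transpose_def matrix_vector_mult_basis column_def inner_axis')
qed

text \<open>All perturbations of test functions below have this shape: \<open>c > 0\<close> opens
  them in the stability proof, \<open>c < 0\<close> flattens them in the bump construction, and a
  constant \<phi> yields paraboloids.\<close>

lemma C2_on_add_quadratic:
  fixes \<phi> :: "real^'n \<Rightarrow> real" and a :: "real^'n" and c k :: real
  assumes C2: "C2_on S \<phi>"
  defines "\<psi> \<equiv> (\<lambda>x. \<phi> x + c * (norm (x - a))\<^sup>2 + k)"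
  shows "C2_on S \<psi>"
    and "\<And>x. x \<in> S \<Longrightarrow> gradient \<psi> x = gradient \<phi> x + (2 * c) *\<^sub>R (x - a)"
    and "\<And>x. x \<in> S \<Longrightarrow> hessian \<psi> x = hessian \<phi> x + (2 * c) *\<^sub>R mat 1"
proof -
  have "open S"
    using C2 by (simp add: C2_on_def)
  have D\<psi>: "(\<psi> has_derivative (\<lambda>h. (gradient \<phi> x + (2 * c) *\<^sub>R (x - a)) \<bullet> h)) (at x)" if "x \<in> S" for x
    unfolding \<psi>_def power2_norm_eq_inner
    by (auto intro!: derivative_eq_intros C2_onD(1)[OF C2 that] ext simp: inner_add_left inner_commute algebra_simps)
  show grad: "gradient \<psi> x = gradient \<phi> x + (2 * c) *\<^sub>R (x - a)" if "x \<in> S" for x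
    by (rule gradient_eqI[OF D\<psi>[OF that]])
  have D2: "(gradient \<psi> has_derivative (\<lambda>h. (hessian \<phi> x + (2 * c) *\<^sub>R mat 1) *v h)) (at x)"
    if "x \<in> S" for x
  proof (rule has_derivative_transform_within_open[OF _ \<open>open S\<close> that])
    show "((\<lambda>x. gradient \<phi> x + (2 * c) *\<^sub>R (x - a)) has_derivative
        (\<lambda>h. (hessian \<phi> x + (2 * c) *\<^sub>R mat 1) *v h)) (at x)"
      by (auto intro!: derivative_eq_intros C2_onD(2)[OF C2 that]
          simp: matrix_vector_mult_add_rdistrib scaleR_matrix_vector_assoc[symmetric])
  qed (simp add: grad)
  show hess: "hessian \<psi> x = hessian \<phi> x + (2 * c) *\<^sub>R mat 1" if "x \<in> S" for x
    by (rule hessian_eqI[OF D2[OF that]])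
  have "continuous_on S (\<lambda>x. hessian \<phi> x + (2 * c) *\<^sub>R mat 1)"
    by (intro continuous_intros C2_on_continuous(3)[OF C2])
  then have "continuous_on S (hessian \<psi>)"
    using hess continuous_on_cong by (metis (no_types, lifting))
  then show "C2_on S \<psi>"
    unfolding C2_on_def differentiable_on_eq_differentiable_at[OF \<open>open S\<close>]
    using \<open>open S\<close> D\<psi> D2 by (auto simp: differentiable_def)
qed

lemma quadratic_form_add_scaled_identity:
  fixes H :: "real^'n^'n"
  shows "x \<bullet> ((H + c *\<^sub>R mat 1) *v x) = x \<bullet> (H *v x) + c * (norm x)\<^sup>2"
  by (simp add: matrix_vector_mult_add_rdistrib scaleR_matrix_vector_assoc[symmetric]
      inner_add_right power2_norm_eq_inner)

section \<open>Convexity through restriction to lines\<close>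

lemma line_preimage:
  fixes x \<xi> :: "'a::real_normed_vector"
  shows "open C \<Longrightarrow> open {t::real. x + t *\<^sub>R \<xi> \<in> C}"
    and "convex C \<Longrightarrow> convex {t::real. x + t *\<^sub>R \<xi> \<in> C}"
proof -
  assume "open C"
  then have "open ((\<lambda>t::real. x + t *\<^sub>R \<xi>) -` C)"
    by (intro open_vimage continuous_intros)
  then show "open {t::real. x + t *\<^sub>R \<xi> \<in> C}"
    by (simp add: vimage_def)
next
  assume "convex C"
  show "convex {t::real. x + t *\<^sub>R \<xi> \<in> C}"
    unfolding convex_alt
  proof (intro ballI allI impI, goal_cases)
    case (1 t s u)
    then have "(1 - u) *\<^sub>R (x + t *\<^sub>R \<xi>) + u *\<^sub>R (x + s *\<^sub>R \<xi>) \<in> C"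
      using \<open>convex C\<close> by (auto simp: convex_alt)
    then show ?case
      by (simp add: algebra_simps)
  qed
qed

lemma convex_on_line:
  fixes x \<xi> :: "'a::real_normed_vector"
  assumes "convex_on C \<phi>"
  shows "convex_on {t::real. x + t *\<^sub>R \<xi> \<in> C} (\<lambda>t. \<phi> (x + t *\<^sub>R \<xi>))"
proof (rule convex_onI)
  fix t a b :: real
  assume "0 < t" "t < 1" "a \<in> {t. x + t *\<^sub>R \<xi> \<in> C}" "b \<in> {t. x + t *\<^sub>R \<xi> \<in> C}"
  then have "\<phi> ((1 - t) *\<^sub>R (x + a *\<^sub>R \<xi>) + t *\<^sub>R (x + b *\<^sub>R \<xi>))
      \<le> (1 - t) * \<phi> (x + a *\<^sub>R \<xi>) + t * \<phi> (x + b *\<^sub>R \<xi>)"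
    by (intro convex_onD[OF assms]) auto
  then show "\<phi> (x + ((1 - t) *\<^sub>R a + t *\<^sub>R b) *\<^sub>R \<xi>)
      \<le> (1 - t) * \<phi> (x + a *\<^sub>R \<xi>) + t * \<phi> (x + b *\<^sub>R \<xi>)"
    by (simp add: algebra_simps)
qed (use assms in \<open>auto intro: line_preimage convex_on_imp_convex\<close>)

text \<open>The derivatives are supplied line by line, as functions of base point, direction and
  parameter, so that the criterion covers both \<open>C2_on\<close> functions and the explicit
  barrier.\<close>

lemma convex_on_if_second_derivative_nonneg:
  fixes \<phi> :: "'a::real_normed_vector \<Rightarrow> real"
  assumes "convex C"
    and d1: "\<And>x \<xi> s. x + s *\<^sub>R \<xi> \<in> C \<Longrightarrow> ((\<lambda>s. \<phi> (x + s *\<^sub>R \<xi>)) has_real_derivative D1 x \<xi> s) (at s)"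
    and d2: "\<And>x \<xi> s. x + s *\<^sub>R \<xi> \<in> C \<Longrightarrow> ((\<lambda>s. D1 x \<xi> s) has_real_derivative D2 x \<xi> s) (at s)"
    and nonneg: "\<And>x \<xi> s. x + s *\<^sub>R \<xi> \<in> C \<Longrightarrow> 0 \<le> D2 x \<xi> s"
  shows "convex_on C \<phi>"
proof (rule convex_onI)
  fix t :: real and x y assume "0 < t" "t < 1" "x \<in> C" "y \<in> C"
  have "convex_on {t. x + t *\<^sub>R (y - x) \<in> C} (\<lambda>t. \<phi> (x + t *\<^sub>R (y - x)))"
    by (rule f''_ge0_imp_convex[OF line_preimage(2)[OF \<open>convex C\<close>],
          of _ _ _ "D1 x (y - x)" "D2 x (y - x)"]) (auto intro: d1 d2 nonneg)
  from convex_onD[OF this, of t 0 1] show "\<phi> ((1 - t) *\<^sub>R x + t *\<^sub>R y) \<le> (1 - t) * \<phi> x + t * \<phi> y"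
    using \<open>0 < t\<close> \<open>t < 1\<close> \<open>x \<in> C\<close> \<open>y \<in> C\<close> by (simp add: algebra_simps)
qed fact

lemma convex_on_if_hessian_psd:
  fixes \<phi> :: "real^'n \<Rightarrow> real"
  assumes "C2_on C \<phi>" "convex C" "\<And>x \<xi>. x \<in> C \<Longrightarrow> 0 \<le> \<xi> \<bullet> (hessian \<phi> x *v \<xi>)"
  shows "convex_on C \<phi>"
  by (rule convex_on_if_second_derivative_nonneg[OF assms(2)])
    (auto intro: has_real_derivative_line_gradient[OF assms(1)]
      has_real_derivative_line_hessian[OF assms(1)] assms(3))

lemma convex_above_tangent:
  fixes \<phi> :: "real^'n \<Rightarrow> real"
  assumes "convex_on C \<phi>" "open C" "x \<in> C" "y \<in> C"
    and "(\<phi> has_derivative (\<lambda>h. g \<bullet> h)) (at x)"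
  shows "\<phi> x + g \<bullet> (y - x) \<le> \<phi> y"
proof -
  let ?A = "{t::real. x + t *\<^sub>R (y - x) \<in> C}"
  have "convex C"
    using assms(1) by (rule convex_on_imp_convex)
  have "((\<lambda>t. \<phi> (x + t *\<^sub>R (y - x))) has_real_derivative g \<bullet> (y - x)) (at 0)"
    using assms(5) by (intro has_real_derivative_line) simp
  then have "\<phi> (x + 1 *\<^sub>R (y - x)) - \<phi> (x + 0 *\<^sub>R (y - x)) \<ge> (g \<bullet> (y - x)) * (1 - 0)"
    using assms(3,4) \<open>convex C\<close>
    by (intro convex_on_imp_above_tangent[OF convex_on_line[OF assms(1)]])
      (auto simp: interior_open line_preimage(1)[OF assms(2)] intro: convex_connected line_preimage has_field_derivative_at_within)
  then show ?thesis by simp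
qed

lemma hessian_psd_if_convex:
  fixes \<phi> :: "real^'n \<Rightarrow> real"
  assumes C2: "C2_on S \<phi>" and conv: "convex_fun_on S \<phi>" and "x \<in> S"
  shows "0 \<le> \<xi> \<bullet> (hessian \<phi> x *v \<xi>)"
proof (cases "\<xi> = 0")
  case False
  obtain r where r: "0 < r" "ball x r \<subseteq> S"
    using C2 \<open>x \<in> S\<close> by (meson C2_on_def openE)
  have conv: "convex_on (ball x r) \<phi>"
    using conv r unfolding convex_fun_on_def by simp
  define d where "d = r / norm \<xi>"
  have "0 < d"
    using False r by (simp add: d_def)
  have in_ball: "x + s *\<^sub>R \<xi> \<in> ball x r" if "\<bar>s\<bar> < d" for s
    using that False by (simp add: d_def dist_norm pos_less_divide_eq)
  \<comment> \<open>Subtracting the tangent at \<open>x\<close> makes \<open>s = 0\<close> a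
    minimum, by convexity on the ball, and keeps the second derivative.\<close>
  let ?g = "\<lambda>s. \<phi> (x + s *\<^sub>R \<xi>) - s * (gradient \<phi> x \<bullet> \<xi>)"
  let ?g' = "\<lambda>s. gradient \<phi> (x + s *\<^sub>R \<xi>) \<bullet> \<xi> - gradient \<phi> x \<bullet> \<xi>"
  show ?thesis
  proof (rule second_derivative_test_local_min(2)[OF \<open>0 < d\<close>, of ?g ?g'])
    show "(?g has_real_derivative ?g' s) (at s)" if "\<bar>s\<bar> < d" for s
      using in_ball[OF that] r(2)
      by (auto intro!: derivative_eq_intros has_real_derivative_line_gradient[OF C2])
    show "(?g' has_real_derivative \<xi> \<bullet> (hessian \<phi> x *v \<xi>)) (at 0)"
      using has_real_derivative_line_hessian[OF C2, of x 0 \<xi> \<xi>] \<open>x \<in> S\<close>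
      by (auto intro!: derivative_eq_intros)
    show "?g 0 \<le> ?g s" if "\<bar>s\<bar> < d" for s
      using convex_above_tangent[OF conv open_ball _ in_ball[OF that] C2_onD(1)[OF C2 \<open>x \<in> S\<close>]] r(1)
      by simp
  qed
qed simp

text \<open>The function \<open>w\<close> touched from above is described by its restrictions to lines, so that the
  criterion applies to explicit barriers without computing their Hessians.\<close>

lemma touching_from_above:
  fixes \<phi> w :: "real^'n \<Rightarrow> real"
  assumes C2: "C2_on S \<phi>" and "x \<in> S" and "0 < r" "ball x r \<subseteq> S"
    and d1: "\<And>\<xi> s. x + s *\<^sub>R \<xi> \<in> ball x r \<Longrightarrow>
      ((\<lambda>s. w (x + s *\<^sub>R \<xi>)) has_real_derivative D1 \<xi> s) (at s)"
    and d2: "\<And>\<xi>. ((\<lambda>s. D1 \<xi> s) has_real_derivative Q \<xi>) (at 0)"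
    and min: "\<And>y. y \<in> ball x r \<Longrightarrow> \<phi> x - w x \<le> \<phi> y - w y"
  shows "gradient \<phi> x \<bullet> \<xi> = D1 \<xi> 0" "Q \<xi> \<le> \<xi> \<bullet> (hessian \<phi> x *v \<xi>)"
proof -
  \<comment> \<open>The summand 1 keeps \<open>d\<close> positive also for
    \<open>\<xi> = 0\<close>.\<close>
  define d where "d = r / (norm \<xi> + 1)"
  have n1: "0 < norm \<xi> + 1"
    by (simp add: add_nonneg_pos)
  have "0 < d"
    using \<open>0 < r\<close> n1 by (simp add: d_def)
  have in_ball: "x + s *\<^sub>R \<xi> \<in> ball x r" if "\<bar>s\<bar> < d" for s
  proof -
    have "\<bar>s\<bar> * norm \<xi> \<le> \<bar>s\<bar> * (norm \<xi> + 1)"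
      by (intro mult_left_mono) auto
    also have "\<dots> < r"
      using that n1 by (simp add: d_def pos_less_divide_eq)
    finally show ?thesis
      by (simp add: dist_norm)
  qed
  let ?g = "\<lambda>s. \<phi> (x + s *\<^sub>R \<xi>) - w (x + s *\<^sub>R \<xi>)"
  let ?g' = "\<lambda>s. gradient \<phi> (x + s *\<^sub>R \<xi>) \<bullet> \<xi> - D1 \<xi> s"
  have 1: "(?g has_real_derivative ?g' s) (at s)" if "\<bar>s\<bar> < d" for s
    using in_ball[OF that] \<open>ball x r \<subseteq> S\<close>
    by (intro DERIV_diff d1 has_real_derivative_line_gradient[OF C2]) auto
  have 2: "(?g' has_real_derivative \<xi> \<bullet> (hessian \<phi> x *v \<xi>) - Q \<xi>) (at 0)"
    using has_real_derivative_line_hessian[OF C2, of x 0 \<xi> \<xi>] \<open>x \<in> S\<close>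
    by (intro DERIV_diff d2) simp
  have 3: "?g 0 \<le> ?g s" if "\<bar>s\<bar> < d" for s
    using min[OF in_ball[OF that]] by simp
  show "gradient \<phi> x \<bullet> \<xi> = D1 \<xi> 0"
    using second_derivative_test_local_min(1)[OF \<open>0 < d\<close> 1 2 3] by simp
  show "Q \<xi> \<le> \<xi> \<bullet> (hessian \<phi> x *v \<xi>)"
    using second_derivative_test_local_min(2)[OF \<open>0 < d\<close> 1 2 3] by simp
qed

section \<open>Continuity of determinants and stability of definiteness\<close>

lemma continuous_on_det [continuous_intros]:
  fixes A :: "'a::topological_space \<Rightarrow> real^'n^'n"
  assumes "continuous_on S A"
  shows "continuous_on S (\<lambda>x. det (A x))"
  unfolding det_def by (intro continuous_intros assms)

lemma pd_imp_uniformly_pd: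
  fixes A :: "real^'n^'n"
  assumes "\<And>x. x \<noteq> 0 \<Longrightarrow> 0 < x \<bullet> (A *v x)"
  obtains c where "0 < c" "\<And>x. c * (norm x)\<^sup>2 \<le> x \<bullet> (A *v x)"
proof -
  have "continuous_on (sphere 0 1) (\<lambda>x. x \<bullet> (A *v x))"
    by (intro continuous_intros linear_continuous_on matrix_vector_mul_bounded_linear)
  moreover have "axis undefined 1 \<in> sphere (0::real^'n) 1"
    by (simp add: norm_axis_1)
  ultimately obtain z where z: "z \<in> sphere 0 1" "\<And>y. y \<in> sphere 0 1 \<Longrightarrow> z \<bullet> (A *v z) \<le> y \<bullet> (A *v y)"
    using continuous_attains_inf[of "sphere 0 1" "\<lambda>x. x \<bullet> (A *v x)"] by auto
  show thesis
  proof
    show "0 < z \<bullet> (A *v z)"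
      using z(1) by (intro assms) auto
    show "(z \<bullet> (A *v z)) * (norm x)\<^sup>2 \<le> x \<bullet> (A *v x)" for x
    proof (cases "x = 0")
      case False
      then have "z \<bullet> (A *v z) \<le> (x /\<^sub>R norm x) \<bullet> (A *v (x /\<^sub>R norm x))"
        by (intro z(2)) auto
      also have "\<dots> = (x \<bullet> (A *v x)) / (norm x)\<^sup>2"
        by (simp add: matrix_vector_mult_scaleR power2_eq_square field_simps)
      finally show ?thesis
        using False by (simp add: pos_le_divide_eq)
    qed simp
  qed
qed

text \<open>\<open>norm A\<close> is the Frobenius norm here; Cauchy-Schwarz in each row shows that
  it dominates the operator norm.\<close>

lemma norm_matrix_vector_mult_le:
  fixes A :: "real^'n^'m"
  shows "norm (A *v x) \<le> norm A * norm x"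
proof -
  have "norm (A *v x) \<le> L2_set (\<lambda>i. norm (A $ i) * norm x) UNIV"
    unfolding norm_vec_def[of "A *v x"]
    by (intro L2_set_mono) (simp_all add: matrix_vector_mul_component Cauchy_Schwarz_ineq2)
  then show ?thesis
    by (simp add: norm_vec_def[of A] L2_set_left_distrib)
qed

lemma quadratic_form_diff_le:
  fixes A B :: "real^'n^'n"
  shows "\<bar>x \<bullet> (A *v x) - x \<bullet> (B *v x)\<bar> \<le> norm (A - B) * (norm x)\<^sup>2"
proof -
  have "x \<bullet> (A *v x) - x \<bullet> (B *v x) = x \<bullet> ((A - B) *v x)"
    by (simp add: matrix_vector_mult_diff_rdistrib inner_diff_right)
  also have "\<bar>\<dots>\<bar> \<le> norm x * norm ((A - B) *v x)"
    by (rule Cauchy_Schwarz_ineq2)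
  also have "\<dots> \<le> norm x * (norm (A - B) * norm x)"
    by (intro mult_left_mono norm_matrix_vector_mult_le) auto
  finally show ?thesis
    by (simp add: power2_eq_square ac_simps)
qed

section \<open>Perron's method\<close>

lemma C2_on_const:
  fixes k :: real and S :: "(real^'n) set"
  assumes "open S"
  shows "C2_on S (\<lambda>_. k)" "gradient (\<lambda>_::real^'n. k) x = 0" "hessian (\<lambda>_::real^'n. k) x = 0"
proof -
  have grad: "gradient (\<lambda>_. k) = (\<lambda>_::real^'n. 0)"
    by (intro ext gradient_eqI) simp
  have hess: "hessian (\<lambda>_. k) = (\<lambda>_::real^'n. 0)"
    by (intro ext hessian_eqI) (simp add: grad)
  show "C2_on S (\<lambda>_. k)" "gradient (\<lambda>_. k) x = 0" "hessian (\<lambda>_. k) x = 0"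
    using assms by (simp_all add: C2_on_def grad hess)
qed

lemma det_scaled_identity: "det (c *\<^sub>R mat 1 :: real^'n^'n) = c ^ CARD('n)"
  by (subst det_diagonal) (auto simp: mat_def)

lemma convex_on_norm_square:
  fixes a :: "real^'n"
  assumes "0 \<le> c" "convex C"
  shows "convex_on C (\<lambda>x. c * (norm (x - a))\<^sup>2 + k)"
proof -
  note C2 = C2_on_add_quadratic[OF C2_on_const(1)[OF open_UNIV, of 0], where c = c and a = a and k = k]
  \<comment> \<open>The summand 0 is the constant function to which
    \<open>C2_on_add_quadratic\<close> is applied.\<close>
  have "convex_on UNIV (\<lambda>x. 0 + c * (norm (x - a))\<^sup>2 + k)"
    using assms(1)
    by (intro convex_on_if_hessian_psd C2(1))
      (simp_all add: C2(3) C2_on_const(3)[OF open_UNIV] quadratic_form_add_scaled_identity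
        del: add_0 add_0_left)
  then show ?thesis
    using assms(2) by (auto intro: convex_on_subset)
qed

lemma convex_fun_on_add_quadratic:
  fixes \<phi> :: "real^'n \<Rightarrow> real"
  assumes "convex_fun_on S \<phi>" "0 \<le> c"
  shows "convex_fun_on S (\<lambda>x. \<phi> x + c * (norm (x - a))\<^sup>2 + k)"
  unfolding convex_fun_on_def
proof (intro allI impI)
  fix C assume C: "C \<subseteq> S \<and> convex C"
  then have "convex_on C \<phi>"
    using assms(1) by (simp add: convex_fun_on_def)
  from convex_on_add[OF this convex_on_norm_square[OF assms(2)]]
  show "convex_on C (\<lambda>x. \<phi> x + c * (norm (x - a))\<^sup>2 + k)"
    using C by (simp add: add.assoc)
qed

lemma convex_fun_on_subset:
  assumes "convex_fun_on S \<phi>" "T \<subseteq> S"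
  shows "convex_fun_on T \<phi>"
  using assms unfolding convex_fun_on_def by (meson subset_trans)

text \<open>Fixes the size of a perturbation: a strict inequality at parameter 0 survives for some
  positive parameter. The next lemma does the same for the radius of a ball.\<close>

lemma continuous_negative_right:
  fixes g :: "real \<Rightarrow> real"
  assumes "continuous_on {0..b} g" "0 < b" "g 0 < 0"
  obtains e where "0 < e" "e \<le> b" "g e < 0"
proof -
  obtain d where d: "0 < d" "\<And>x. x \<in> {0..b} \<Longrightarrow> dist x 0 < d \<Longrightarrow> dist (g x) (g 0) < - g 0"
    using assms unfolding continuous_on_iff by (metis atLeastAtMost_iff less_eq_real_def neg_0_less_iff_less)
  define e where "e = min b (d / 2)"
  have "0 < e" "e \<le> b" "e < d"
    using d(1) assms(2) by (auto simp: e_def)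
  with d(2)[of e] have "g e < 0"
    by (simp add: dist_real_def)
  with \<open>0 < e\<close> \<open>e \<le> b\<close> show thesis ..
qed

lemma continuous_negative_neighbourhood:
  fixes g :: "'a::metric_space \<Rightarrow> real"
  assumes "continuous_on W g" "open W" "x \<in> W" "g x < 0"
  shows "\<exists>r>0. cball x r \<subseteq> W \<and> (\<forall>y\<in>cball x r. g y < 0)"
proof -
  have "open (W \<inter> g -` {..<0})"
    using continuous_open_preimage[OF assms(1,2)] by simp
  then obtain r where "0 < r" "cball x r \<subseteq> W \<inter> g -` {..<0}"
    using assms(3,4) by (metis IntI lessThan_iff open_contains_cball vimageI)
  then show ?thesis
    by blast
qed

lemma viscosity_candidate_nonpos:
  assumes "viscosity_candidate \<Omega> v" "x \<in> closure \<Omega>"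
  shows "v x \<le> 0"
  using assms unfolding viscosity_candidate_def
  by (intro continuous_le_on_closure[of \<Omega> v x 0]) auto

text \<open>The conditions on which Perron's method runs. The upper growth bound of \<open>f\<close>
  enters later, through the barriers.\<close>

locale monge_ampere =
  fixes \<Omega> :: "(real^'n) set" and f :: "real^'n \<Rightarrow> real \<Rightarrow> real^'n \<Rightarrow> real"
  assumes open_domain: "open \<Omega>" and bounded_domain: "bounded \<Omega>" and convex_domain: "convex \<Omega>"
    and continuous_rhs: "continuous_on (\<Omega> \<times> {..<0} \<times> UNIV) (\<lambda>(x, z, q). f x z q)"
    and mono_rhs: "\<And>x q. x \<in> \<Omega> \<Longrightarrow> mono_on {..<0} (\<lambda>z. f x z q)"
    and pos_rhs: "\<And>x z q. x \<in> \<Omega> \<Longrightarrow> z < 0 \<Longrightarrow> 0 < f x z q"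
begin

lemma continuous_on_rhs:
  assumes "continuous_on S a" "continuous_on S b" "continuous_on S c"
    and "\<And>s. s \<in> S \<Longrightarrow> a s \<in> \<Omega>" "\<And>s. s \<in> S \<Longrightarrow> b s < 0"
  shows "continuous_on S (\<lambda>s. f (a s) (b s) (c s))"
proof -
  have "continuous_on S (\<lambda>s. (a s, b s, c s))"
    by (intro continuous_intros assms)
  from continuous_on_compose2[OF continuous_rhs this] assms(4,5) show ?thesis
    by auto
qed

lemma rhs_mono:
  assumes "x \<in> \<Omega>" "y \<le> z" "z < 0"
  shows "f x y q \<le> f x z q"
  using mono_rhs[OF assms(1), of q] assms(2,3) by (auto simp: mono_on_def)

lemma subsolution_test:
  assumes "viscosity_subsolution f \<Omega> v" "x \<in> W" "W \<subseteq> \<Omega>" "C2_on W \<phi>" "convex_fun_on W \<phi>"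
    and "\<And>y. y \<in> W \<Longrightarrow> \<phi> x - v x \<le> \<phi> y - v y"
  shows "f x (v x) (gradient \<phi> x) \<le> det (hessian \<phi> x)"
proof -
  have "open W" "W \<inter> \<Omega> = W" "x \<in> \<Omega>"
    using assms by (auto simp: C2_on_def)
  with assms show ?thesis
    unfolding viscosity_subsolution_def by metis
qed

text \<open>Comparison with a paraboloid of small opening on a ball: it depends on the subsolution only
  through its lower bound.\<close>

lemma subsolutions_uniformly_negative:
  assumes "x0 \<in> \<Omega>"
  shows "\<exists>c<0. \<forall>v. viscosity_subsolution f \<Omega> v \<and> (\<forall>x\<in>\<Omega>. - M \<le> v x) \<longrightarrow> v x0 \<le> c"
proof -
  obtain r where r: "0 < r" "cball x0 r \<subseteq> \<Omega>"
    using open_domain assms open_contains_cball by blast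
  \<comment> \<open>At least 1, so that \<open>- m\<close> is an admissible second argument of
    \<open>f\<close>.\<close>
  define m where "m = max M 1"
  \<comment> \<open>The second factor contains the gradients of the paraboloid on the ball, of norm
    at most \<open>\<epsilon> * r\<close> with \<open>\<epsilon> \<le> 1\<close>.\<close>
  define K where "K = cball x0 r \<times> cball (0::real^'n) r"
  have "compact K" "(x0, 0) \<in> K"
    using r(1) by (auto simp: K_def compact_Times)
  moreover have "continuous_on K (\<lambda>p. f (fst p) (- m) (snd p))"
    using r(2) by (intro continuous_on_rhs continuous_intros) (auto simp: K_def m_def)
  ultimately obtain p where p: "p \<in> K" "\<And>p'. p' \<in> K \<Longrightarrow> f (fst p) (- m) (snd p) \<le> f (fst p') (- m) (snd p')"
    using continuous_attains_inf[of K] by blast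
  define l where "l = f (fst p) (- m) (snd p)"
  have "0 < l"
    using p(1) r(2) unfolding l_def by (intro pos_rhs) (auto simp: K_def m_def)
  \<comment> \<open>\<open>\<epsilon> \<le> 1\<close> bounds the determinant
    \<open>\<epsilon> ^ CARD('n)\<close> by \<epsilon>, and \<open>l / 2\<close> keeps \<epsilon>
    strictly below the minimum \<open>l\<close> of \<open>f\<close>.\<close>
  define \<epsilon> where "\<epsilon> = min 1 (l / 2)"
  have \<epsilon>: "0 < \<epsilon>" "\<epsilon> \<le> 1" "\<epsilon> < l"
    using \<open>0 < l\<close> by (auto simp: \<epsilon>_def)
  have "\<epsilon> ^ CARD('n) \<le> \<epsilon>"
    using \<epsilon> power_decreasing[of 1 "CARD('n)" \<epsilon>] by simp
  define \<phi> where "\<phi> = (\<lambda>x. 0 + \<epsilon> / 2 * (norm (x - x0))\<^sup>2 + (- (\<epsilon> / 2 * r\<^sup>2)))"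
  note C2 = C2_on_add_quadratic[OF C2_on_const(1)[OF open_ball, where k = 0, of x0 r],
      where c = "\<epsilon> / 2" and a = x0 and k = "- (\<epsilon> / 2 * r\<^sup>2)",
      folded \<phi>_def]
  have conv: "convex_fun_on (ball x0 r) \<phi>"
    unfolding \<phi>_def using \<epsilon> convex_on_const[of _ "0::real"]
    by (intro convex_fun_on_add_quadratic) (auto simp: convex_fun_on_def)
  show ?thesis
  proof (intro exI conjI allI impI)
    show "- (\<epsilon> / 2 * r\<^sup>2) < 0"
      using \<epsilon> r(1) by simp
    fix v assume "viscosity_subsolution f \<Omega> v \<and> (\<forall>x\<in>\<Omega>. - M \<le> v x)"
    then have v: "viscosity_subsolution f \<Omega> v" "\<And>x. x \<in> \<Omega> \<Longrightarrow> - M \<le> v x"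
      by auto
    then have cand: "continuous_on (closure \<Omega>) v" "\<And>x. x \<in> \<Omega> \<Longrightarrow> v x < 0"
      by (auto simp: viscosity_subsolution_def viscosity_candidate_def)
    have "continuous_on (cball x0 r) (\<lambda>x. \<phi> x - v x)"
      unfolding \<phi>_def using cand(1) r(2) closure_subset[of \<Omega>]
      by (intro continuous_intros) (meson continuous_on_subset subset_trans)
    then obtain x1 where x1: "x1 \<in> cball x0 r" "\<And>x. x \<in> cball x0 r \<Longrightarrow> \<phi> x1 - v x1 \<le> \<phi> x - v x"
      using continuous_attains_inf[of "cball x0 r" "\<lambda>x. \<phi> x - v x"] r(1) by auto
    \<comment> \<open>A negative minimum cannot lie on the sphere, where \<phi> vanishes and
      \<open>v\<close> is negative; inside, the paraboloid is an admissible test function whose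
      determinant is too small.\<close>
    have "0 \<le> \<phi> x1 - v x1"
    proof (rule ccontr)
      assume neg: "\<not> 0 \<le> \<phi> x1 - v x1"
      have "x1 \<in> \<Omega>"
        using x1(1) r(2) by auto
      have "x1 \<in> ball x0 r"
      proof (rule ccontr)
        assume "x1 \<notin> ball x0 r"
        then have "norm (x1 - x0) = r"
          using x1(1) by (simp add: dist_norm norm_minus_commute)
        then have "\<phi> x1 = 0"
          by (simp add: \<phi>_def)
        then show False
          using neg cand(2)[OF \<open>x1 \<in> \<Omega>\<close>] by simp
      qed
      have "f x1 (v x1) (gradient \<phi> x1) \<le> det (hessian \<phi> x1)"
        using r(2) x1(2) by (intro subsolution_test[OF v(1) \<open>x1 \<in> ball x0 r\<close>] C2(1) conv) auto
      also have "\<dots> = \<epsilon> ^ CARD('n)"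
        using C2(3)[OF \<open>x1 \<in> ball x0 r\<close>] by (simp add: C2_on_const(3)[OF open_ball] det_scaled_identity)
      also have "\<dots> < l"
        using \<open>\<epsilon> ^ CARD('n) \<le> \<epsilon>\<close> \<epsilon> by simp
      also have "l \<le> f x1 (- m) (gradient \<phi> x1)"
      proof -
        have "gradient \<phi> x1 = \<epsilon> *\<^sub>R (x1 - x0)"
          using C2(2)[OF \<open>x1 \<in> ball x0 r\<close>] by (simp add: C2_on_const(2)[OF open_ball])
        moreover have "\<epsilon> * norm (x1 - x0) \<le> 1 * r"
          using \<epsilon> x1(1) r(1) by (intro mult_mono) (auto simp: dist_norm norm_minus_commute)
        ultimately have "(x1, gradient \<phi> x1) \<in> K"
          using x1(1) \<epsilon> by (simp add: K_def)
        from p(2)[OF this] show ?thesis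
          by (simp add: l_def)
      qed
      also have "\<dots> \<le> f x1 (v x1) (gradient \<phi> x1)"
        using v(2)[OF \<open>x1 \<in> \<Omega>\<close>] cand(2)[OF \<open>x1 \<in> \<Omega>\<close>]
        by (intro rhs_mono \<open>x1 \<in> \<Omega>\<close>) (auto simp: m_def)
      finally show False
        by simp
    qed
    then have "v x0 \<le> \<phi> x0"
      using x1(2)[of x0] r(1) by simp
    then show "v x0 \<le> - (\<epsilon> / 2 * r\<^sup>2)"
      by (simp add: \<phi>_def)
  qed
qed

text \<open>The supremum need not be attained, so a test function touching it may touch no member of
  the family. Opening it by \<open>e * (norm (x - x0))\<^sup>2\<close> makes the contact strict, and
  a member nearly optimal at \<open>x0\<close> is then touched at some \<open>x1\<close> close by.
  There \<open>f\<close> is compared at the lower value \<open>u x0 - e\<close>, by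
  monotonicity.\<close>

lemma viscosity_subsolution_SUP:
  assumes "\<S> \<noteq> {}" and sub: "\<And>v. v \<in> \<S> \<Longrightarrow> viscosity_subsolution f \<Omega> v"
    and cand: "viscosity_candidate \<Omega> (\<lambda>x. SUP v\<in>\<S>. v x)"
  shows "viscosity_subsolution f \<Omega> (\<lambda>x. SUP v\<in>\<S>. v x)"
proof -
  define u where "u x = (SUP v\<in>\<S>. v x)" for x
  have v_cand: "continuous_on (closure \<Omega>) v" "v x \<le> 0" "x \<in> \<Omega> \<Longrightarrow> v x < 0"
    if "v \<in> \<S>" "x \<in> closure \<Omega>" for v x
    using sub[OF that(1)] viscosity_candidate_nonpos[OF _ that(2), of v]
    by (auto simp: viscosity_subsolution_def viscosity_candidate_def)
  have bdd: "bdd_above ((\<lambda>v. v x) ` \<S>)" if "x \<in> closure \<Omega>" for x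
    using v_cand(2)[OF _ that] by (auto intro!: bdd_aboveI)
  have v_le: "v x \<le> u x" if "v \<in> \<S>" "x \<in> closure \<Omega>" for v x
    unfolding u_def using bdd[OF that(2)] that(1) by (intro cSUP_upper)
  have u_neg: "u x < 0" if "x \<in> \<Omega>" for x
    using cand that by (simp add: viscosity_candidate_def u_def)
  have "f x0 (u x0) (gradient \<phi> x0) \<le> det (hessian \<phi> x0)"
    if "x0 \<in> \<Omega>" "open U" "x0 \<in> U" and C2: "C2_on (U \<inter> \<Omega>) \<phi>" and conv: "convex_fun_on (U \<inter> \<Omega>) \<phi>"
      and min: "\<And>x. x \<in> U \<inter> \<Omega> \<Longrightarrow> \<phi> x0 - u x0 \<le> \<phi> x - u x" for x0 U \<phi>
  proof (rule ccontr)
    assume neg: "\<not> f x0 (u x0) (gradient \<phi> x0) \<le> det (hessian \<phi> x0)"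
    define W where "W = U \<inter> \<Omega>"
    have W: "open W" "x0 \<in> W" "W \<subseteq> \<Omega>" and C2: "C2_on W \<phi>" and conv: "convex_fun_on W \<phi>"
      using that open_domain by (auto simp: W_def)
    \<comment> \<open>The violated inequality stays strict while the Hessian is raised by
      \<open>2 * e\<close> and the value lowered by \<open>e\<close>.\<close>
    have "continuous_on {0..1} (\<lambda>e. det (hessian \<phi> x0 + (2 * e) *\<^sub>R mat 1) - f x0 (u x0 - e) (gradient \<phi> x0))"
      using u_neg[OF \<open>x0 \<in> \<Omega>\<close>] \<open>x0 \<in> \<Omega>\<close> by (intro continuous_intros continuous_on_rhs) auto
    from continuous_negative_right[OF this] neg obtain e where e: "0 < e"
      "det (hessian \<phi> x0 + (2 * e) *\<^sub>R mat 1) < f x0 (u x0 - e) (gradient \<phi> x0)"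
      by auto
    have "continuous_on W (\<lambda>x. det (hessian \<phi> x + (2 * e) *\<^sub>R mat 1)
        - f x (u x0 - e) (gradient \<phi> x + (2 * e) *\<^sub>R (x - x0)))"
      using u_neg[OF \<open>x0 \<in> \<Omega>\<close>] W e(1) C2_on_continuous[OF C2]
      by (intro continuous_intros continuous_on_rhs) auto
    from continuous_negative_neighbourhood[OF this W(1,2)] e(2) obtain r1 where
      r1: "0 < r1" "cball x0 r1 \<subseteq> W"
        "\<forall>x\<in>cball x0 r1. det (hessian \<phi> x + (2 * e) *\<^sub>R mat 1)
          - f x (u x0 - e) (gradient \<phi> x + (2 * e) *\<^sub>R (x - x0)) < 0"
      by auto
    \<comment> \<open>Of the drop \<open>e\<close> allowed to \<open>v x1\<close>, one half is
      reserved for the variation of \<phi>, the other for the gap between \<open>u x0\<close> and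
      \<open>v x0\<close>.\<close>
    have "continuous_on W (\<lambda>x. \<phi> x0 - \<phi> x - e / 2)"
      by (intro continuous_intros C2_on_continuous[OF C2])
    from continuous_negative_neighbourhood[OF this W(1,2)] e(1) obtain r2 where
      r2: "0 < r2" "\<forall>x\<in>cball x0 r2. \<phi> x0 - \<phi> x - e / 2 < 0"
      by auto
    define r where "r = min r1 r2"
    have r: "0 < r" "cball x0 r \<subseteq> W" "cball x0 r \<subseteq> cball x0 r1" "cball x0 r \<subseteq> cball x0 r2"
      using r1 r2 by (auto simp: r_def)
    have clos: "cball x0 r \<subseteq> closure \<Omega>"
      using r(2) W(3) closure_subset by blast
    \<comment> \<open>\<open>e * r\<^sup>2\<close> is the gain of the opened test function on the
      sphere and forces \<open>x1\<close> into the open ball; \<open>e / 2\<close> yields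
      \<open>u x0 - e \<le> v x1\<close>.\<close>
    have "u x0 - min (e / 2) (e * r\<^sup>2) < u x0"
      using e(1) r(1) by simp
    then obtain v where v: "v \<in> \<S>" "u x0 - min (e / 2) (e * r\<^sup>2) < v x0"
      using less_cSUP_iff[OF \<open>\<S> \<noteq> {}\<close> bdd[of x0]] clos r(1) unfolding u_def
      by (metis centre_in_cball less_imp_le subsetD)
    define \<psi> where "\<psi> = (\<lambda>x. \<phi> x + e * (norm (x - x0))\<^sup>2 + 0)"
    note C2\<psi> = C2_on_add_quadratic[OF C2, where c = e and a = x0 and k = 0, folded \<psi>_def]
    have "continuous_on (cball x0 r) (\<lambda>x. \<psi> x - v x)"
      using C2_on_continuous(1)[OF C2\<psi>(1)] v_cand(1)[OF v(1)] clos r(1,2)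
      by (intro continuous_on_diff) (meson continuous_on_subset subsetD centre_in_cball less_imp_le)+
    then obtain x1 where x1: "x1 \<in> cball x0 r" "\<And>x. x \<in> cball x0 r \<Longrightarrow> \<psi> x1 - v x1 \<le> \<psi> x - v x"
      using continuous_attains_inf[of "cball x0 r" "\<lambda>x. \<psi> x - v x"] r(1) by auto
    have x1_in: "x1 \<in> W" "x1 \<in> \<Omega>" "x1 \<in> closure \<Omega>"
      using x1(1) r(2) W(3) clos by auto
    have at_x0: "\<psi> x1 - v x1 \<le> \<phi> x0 - v x0"
      using x1(2)[of x0] r(1) by (simp add: \<psi>_def)
    have "x1 \<in> ball x0 r"
    proof (rule ccontr)
      assume "x1 \<notin> ball x0 r"
      then have "norm (x1 - x0) = r"
        using x1(1) by (simp add: dist_norm norm_minus_commute)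
      then have "\<psi> x1 = \<phi> x1 + e * r\<^sup>2"
        by (simp add: \<psi>_def)
      then show False
        using min[of x1] x1_in(1) at_x0 v_le[OF v(1) x1_in(3)] v(2) by (simp add: W_def)
    qed
    have "0 \<le> e * (norm (x1 - x0))\<^sup>2"
      using e(1) by simp
    moreover have "\<phi> x0 - \<phi> x1 - e / 2 < 0"
      using r2(2) x1(1) r(4) by blast
    ultimately have v_lower: "u x0 - e \<le> v x1"
      using at_x0 v(2) by (simp add: \<psi>_def)
    have "f x1 (u x0 - e) (gradient \<psi> x1) \<le> f x1 (v x1) (gradient \<psi> x1)"
      using v_lower v_cand(3)[OF v(1) x1_in(3,2)] x1_in by (intro rhs_mono) auto
    also have "\<dots> \<le> det (hessian \<psi> x1)"
    proof (rule subsolution_test[OF sub[OF v(1)] \<open>x1 \<in> ball x0 r\<close>])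
      have sub: "ball x0 r \<subseteq> W"
        using r(2) ball_subset_cball by blast
      then show "ball x0 r \<subseteq> \<Omega>"
        using W(3) by blast
      show "C2_on (ball x0 r) \<psi>"
        using C2_on_subset[OF C2\<psi>(1) sub] by simp
      show "convex_fun_on (ball x0 r) \<psi>"
        unfolding \<psi>_def using e(1)
        by (intro convex_fun_on_add_quadratic convex_fun_on_subset[OF conv sub]) simp
      show "\<psi> x1 - v x1 \<le> \<psi> y - v y" if "y \<in> ball x0 r" for y
        using x1(2) that by simp
    qed
    also have "\<dots> < f x1 (u x0 - e) (gradient \<psi> x1)"
      using bspec[OF r1(3), of x1] x1(1) r(3) C2\<psi>(2,3)[OF x1_in(1)] by auto
    finally show False
      by simp
  qed
  then show ?thesis
    using cand unfolding viscosity_subsolution_def u_def[symmetric] by blast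
qed

text \<open>If the supersolution test fails at \<open>x0\<close>, the test function lifted by a small amount
  is a strict classical subsolution near \<open>x0\<close> and lies above \<open>u\<close> at \<open>x0\<close>
  but below it on a small sphere around \<open>x0\<close>. Gluing keeps global convexity, because a tangent plane of the
  lifted test function falls below the convex function \<open>u\<close> outside that sphere.\<close>

lemma subsolution_bump:
  assumes sub: "viscosity_subsolution f \<Omega> u" and not_super: "\<not> viscosity_supersolution f \<Omega> u"
  obtains v x0 where "viscosity_subsolution f \<Omega> v" "\<And>x. u x \<le> v x" "x0 \<in> \<Omega>" "u x0 < v x0"
proof -
  have cand: "viscosity_candidate \<Omega> u"
    using sub by (simp add: viscosity_subsolution_def)
  then have u_cont: "continuous_on (closure \<Omega>) u" and u_conv: "convex_on (closure \<Omega>) u"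
    and u_neg: "\<And>x. x \<in> \<Omega> \<Longrightarrow> u x < 0"
    by (auto simp: viscosity_candidate_def)
  obtain x0 U \<phi> where x0: "x0 \<in> \<Omega>" "open U" "x0 \<in> U" and C2: "C2_on (U \<inter> \<Omega>) \<phi>"
    and conv: "convex_fun_on (U \<inter> \<Omega>) \<phi>" and max: "\<And>x. x \<in> U \<inter> \<Omega> \<Longrightarrow> \<phi> x - u x \<le> \<phi> x0 - u x0"
    and fail: "f x0 (u x0) (gradient \<phi> x0) < det (hessian \<phi> x0)"
    using not_super cand unfolding viscosity_supersolution_def by (force simp: not_le)
  define W where "W = U \<inter> \<Omega>"
  have W: "open W" "x0 \<in> W" "W \<subseteq> \<Omega>" and C2: "C2_on W \<phi>" and conv: "convex_fun_on W \<phi>"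
    using x0 C2 conv open_domain by (auto simp: W_def)
  note cont = C2_on_continuous[OF C2]
  have sym: "transpose (hessian \<phi> x) = hessian \<phi> x" if "x \<in> W" for x
    using hessian_symmetric[OF C2 that] .
  \<comment> \<open>Positivity of \<open>f\<close> makes the Hessian nonsingular; being positive
    semidefinite by convexity of \<phi>, it is positive definite, and \<phi> can be flattened
    without losing convexity.\<close>
  have "0 < det (hessian \<phi> x0)"
    using fail pos_rhs[OF x0(1) u_neg[OF x0(1)], of "gradient \<phi> x0"] by simp
  then have "0 < \<xi> \<bullet> (hessian \<phi> x0 *v \<xi>)" if "\<xi> \<noteq> 0" for \<xi>
    using psd_det_nonzero_imp_pd[OF sym[OF W(2)] hessian_psd_if_convex[OF C2 conv W(2)] _ that] by simp
  then obtain c where c: "0 < c" "\<And>\<xi>. c * (norm \<xi>)\<^sup>2 \<le> \<xi> \<bullet> (hessian \<phi> x0 *v \<xi>)"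
    using pd_imp_uniformly_pd by blast
  \<comment> \<open>\<open>c / 8\<close> keeps the reduction \<open>2 * e\<close> of the Hessian at
    most \<open>c / 4\<close>; \<open>- u x0 / 2\<close> keeps \<open>u x0 + e\<close> negative,
    where \<open>f\<close> is defined.\<close>
  define b where "b = min (c / 8) (- u x0 / 2)"
  have b: "0 < b" "b \<le> c / 8" "u x0 + b < 0"
    using c(1) u_neg[OF x0(1)] by (auto simp: b_def)
  have "continuous_on {0..b} (\<lambda>e. f x0 (u x0 + e) (gradient \<phi> x0)
      - det (hessian \<phi> x0 + (2 * (- e)) *\<^sub>R mat 1))"
    using b x0(1) by (intro continuous_intros continuous_on_rhs) auto
  from continuous_negative_right[OF this b(1)] fail obtain e where e: "0 < e" "e \<le> b"
    "f x0 (u x0 + e) (gradient \<phi> x0) < det (hessian \<phi> x0 + (2 * (- e)) *\<^sub>R mat 1)"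
    by auto
  have e_neg: "u x0 + e < 0"
    using e(2) b(3) by simp
  have "continuous_on W (\<lambda>x. f x (u x0 + e) (gradient \<phi> x + (2 * (- e)) *\<^sub>R (x - x0))
      - det (hessian \<phi> x + (2 * (- e)) *\<^sub>R mat 1))"
    using e_neg W cont by (intro continuous_intros continuous_on_rhs) auto
  from continuous_negative_neighbourhood[OF this W(1,2)] e(3) obtain r1 where
    r1: "0 < r1" "cball x0 r1 \<subseteq> W" "\<forall>x\<in>cball x0 r1.
      f x (u x0 + e) (gradient \<phi> x + (2 * (- e)) *\<^sub>R (x - x0))
        - det (hessian \<phi> x + (2 * (- e)) *\<^sub>R mat 1) < 0"
    by auto
  have "continuous_on W (\<lambda>x. \<phi> x - \<phi> x0 - e / 2)"
    by (intro continuous_intros cont)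
  from continuous_negative_neighbourhood[OF this W(1,2)] e(1) obtain r2 where
    r2: "0 < r2" "\<forall>x\<in>cball x0 r2. \<phi> x - \<phi> x0 - e / 2 < 0"
    by auto
  \<comment> \<open>Of the margin \<open>c\<close>, half is spent on the oscillation of the Hessian
    and at most a quarter on \<open>2 * e\<close>; a quarter remains.\<close>
  have "continuous_on W (\<lambda>x. norm (hessian \<phi> x0 - hessian \<phi> x) - c / 2)"
    by (intro continuous_intros cont)
  from continuous_negative_neighbourhood[OF this W(1,2)] c(1) obtain r3 where
    r3: "0 < r3" "\<forall>x\<in>cball x0 r3. norm (hessian \<phi> x0 - hessian \<phi> x) - c / 2 < 0"
    by auto
  define R where "R = min r1 (min r2 r3)"
  have R: "0 < R" "ball x0 R \<subseteq> W" "\<And>x. x \<in> ball x0 R \<Longrightarrow> x \<in> cball x0 r1 \<inter> cball x0 r2 \<inter> cball x0 r3"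
    using r1 r2 r3 by (auto simp: R_def)
  \<comment> \<open>The closed ball used for gluing thus lies inside an open ball on which \<psi> is
    convex, so tangent planes are controlled up to the sphere.\<close>
  define r where "r = R / 2"
  have r: "0 < r" "cball x0 r \<subseteq> ball x0 R"
    using R(1) by (auto simp: r_def)
  have rW: "cball x0 r \<subseteq> W"
    using r(2) R(2) by blast
  have clos: "cball x0 r \<subseteq> closure \<Omega>"
    using rW W(3) closure_subset by blast
  \<comment> \<open>The lift: less than \<open>e * r\<^sup>2\<close>, so that \<psi> is under
    \<open>u\<close> on the sphere, and at most \<open>e / 2\<close>, so that lift and rise of
    \<phi> together stay within \<open>e\<close>.\<close>
  define \<delta> where "\<delta> = min (e / 2) (e * r\<^sup>2 / 2)"
  have \<delta>: "0 < \<delta>" "\<delta> \<le> e / 2" "\<delta> < e * r\<^sup>2"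
    using e(1) r(1) by (auto simp: \<delta>_def min_def)
  define \<psi> where "\<psi> = (\<lambda>x. \<phi> x + (- e) * (norm (x - x0))\<^sup>2 + (u x0 - \<phi> x0 + \<delta>))"
  note C2\<psi> = C2_on_add_quadratic[OF C2, where c = "- e" and a = x0
      and k = "u x0 - \<phi> x0 + \<delta>", folded \<psi>_def]
  have pd: "c / 4 * (norm \<xi>)\<^sup>2 \<le> \<xi> \<bullet> (hessian \<psi> x *v \<xi>)" if "x \<in> ball x0 R" for x \<xi>
  proof -
    have "x \<in> W"
      using that R(2) by blast
    have "\<bar>\<xi> \<bullet> (hessian \<phi> x0 *v \<xi>) - \<xi> \<bullet> (hessian \<phi> x *v \<xi>)\<bar> \<le> c / 2 * (norm \<xi>)\<^sup>2"
    proof -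
      have "norm (hessian \<phi> x0 - hessian \<phi> x) \<le> c / 2"
        using r3(2) R(3)[OF that] by force
      then show ?thesis
        using quadratic_form_diff_le[of \<xi> "hessian \<phi> x0" "hessian \<phi> x"]
        by (meson mult_right_mono order_trans zero_le_power2)
    qed
    moreover have "2 * e * (norm \<xi>)\<^sup>2 \<le> c / 4 * (norm \<xi>)\<^sup>2"
      using e(2) b(2) by (intro mult_right_mono) auto
    ultimately show ?thesis
      using c(2)[of \<xi>] unfolding C2\<psi>(3)[OF \<open>x \<in> W\<close>] quadratic_form_add_scaled_identity
      by linarith
  qed
  have pd0: "0 < \<xi> \<bullet> (hessian \<psi> x *v \<xi>)" if "x \<in> ball x0 R" "\<xi> \<noteq> 0" for x \<xi>
  proof -
    have "0 < c / 4 * (norm \<xi>)\<^sup>2"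
      using c(1) that(2) by simp
    also note pd[OF that(1)]
    finally show ?thesis .
  qed
  have \<psi>_conv: "convex_on (ball x0 R) \<psi>"
  proof (rule convex_on_if_hessian_psd)
    show "C2_on (ball x0 R) \<psi>"
      using C2_on_subset[OF C2\<psi>(1) R(2)] by simp
    show "0 \<le> \<xi> \<bullet> (hessian \<psi> x *v \<xi>)" if "x \<in> ball x0 R" for x \<xi>
      using pd0[OF that, of \<xi>] by (cases "\<xi> = 0") auto
  qed simp
  have \<psi>_le: "\<psi> x \<le> u x0 + e" if "x \<in> cball x0 r" for x
  proof -
    have "\<phi> x - \<phi> x0 - e / 2 < 0"
      using r2(2) R(3) r(2) that by blast
    moreover have "0 \<le> e * (norm (x - x0))\<^sup>2"
      using e(1) by simp
    ultimately show ?thesis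
      using \<delta>(2) unfolding \<psi>_def by linarith
  qed
  have \<psi>_sphere: "\<psi> x < u x" if "dist x0 x = r" for x
  proof -
    have "x \<in> U \<inter> \<Omega>"
      using that rW by (auto simp: W_def)
    from max[OF this] \<delta>(3) that show ?thesis
      by (simp add: \<psi>_def dist_norm norm_minus_commute)
  qed
  define v where "v x = (if x \<in> cball x0 r then max (u x) (\<psi> x) else u x)" for x
  have u_le_v: "u x \<le> v x" for x
    by (simp add: v_def)
  have v_cases: "v x = u x \<or> (x \<in> ball x0 r \<and> v x = \<psi> x \<and> u x < \<psi> x)" for x
    using \<psi>_sphere[of x]
    by (cases "dist x0 x" r rule: linorder_cases) (auto simp: v_def max_def)
  have above_tangent: "\<psi> z + gradient \<psi> z \<bullet> (x - z) \<le> v x"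
    if z: "z \<in> ball x0 r" "u z < \<psi> z" and "x \<in> closure \<Omega>" for x z
  proof -
    have "z \<in> cball x0 r"
      using z(1) by simp
    then have zR: "z \<in> ball x0 R" "z \<in> W"
      using r(2) rW by blast+
    have tangent: "\<psi> z + gradient \<psi> z \<bullet> (y - z) \<le> \<psi> y" if "y \<in> cball x0 r" for y
      using r(2) that
      by (intro convex_above_tangent[OF \<psi>_conv open_ball zR(1) _ C2_onD(1)[OF C2\<psi>(1) zR(2)]]) auto
    show ?thesis
    proof (cases "x \<in> cball x0 r")
      case True
      then show ?thesis
        using tangent[OF True] by (simp add: v_def)
    next
      case False
      \<comment> \<open>Where the segment from \<open>z\<close> to \<open>x\<close> leaves the ball,
        the tangent plane is below \<open>u\<close>, while at \<open>z\<close> it is above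
        \<open>u\<close>; convexity of \<open>u\<close> along the segment then keeps it below
        \<open>u\<close> at \<open>x\<close>.\<close>
      have "continuous_on {0..1} (\<lambda>t. dist x0 (z + t *\<^sub>R (x - z)))"
        by (intro continuous_intros)
      then obtain t where t: "0 \<le> t" "t \<le> 1" "dist x0 (z + t *\<^sub>R (x - z)) = r"
        using IVT'[of "\<lambda>t. dist x0 (z + t *\<^sub>R (x - z))" 0 r 1] z(1) False by auto
      then have "0 < t"
        using z(1) by (cases "t = 0") auto
      define p where "p = z + t *\<^sub>R (x - z)"
      have p: "p = (1 - t) *\<^sub>R z + t *\<^sub>R x"
        by (simp add: p_def algebra_simps)
      have "\<psi> z + gradient \<psi> z \<bullet> (p - z) \<le> \<psi> p"
        using t(3) by (intro tangent) (simp add: p_def)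
      also have "\<dots> < u p"
        using \<psi>_sphere t(3) by (simp add: p_def)
      also have "\<dots> \<le> (1 - t) * u z + t * u x"
        unfolding p using z(1) clos t \<open>x \<in> closure \<Omega>\<close>
        by (intro convex_onD[OF u_conv]) auto
      also have "\<dots> \<le> (1 - t) * \<psi> z + t * u x"
        using z(2) t(2) by (intro add_right_mono mult_left_mono) auto
      finally have "t * (\<psi> z + gradient \<psi> z \<bullet> (x - z)) < t * u x"
        by (simp add: p_def algebra_simps)
      then have "\<psi> z + gradient \<psi> z \<bullet> (x - z) < u x"
        using \<open>0 < t\<close> by simp
      also note u_le_v
      finally show ?thesis
        by simp
    qed
  qed
  have v_cont: "continuous_on (closure \<Omega>) v"
  proof -
    have "continuous_on (cball x0 r \<union> (closure \<Omega> - ball x0 r))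
        (\<lambda>x. if x \<in> cball x0 r then max (u x) (\<psi> x) else u x)"
    proof (rule continuous_on_cases)
      show "continuous_on (cball x0 r) (\<lambda>x. max (u x) (\<psi> x))"
        using continuous_on_subset[OF u_cont clos] continuous_on_subset[OF C2_on_continuous(1)[OF C2\<psi>(1)] rW]
        by (intro continuous_intros)
      show "continuous_on (closure \<Omega> - ball x0 r) u"
        using u_cont by (rule continuous_on_subset) auto
      show "\<forall>x. x \<in> cball x0 r \<and> x \<notin> cball x0 r \<or> x \<in> closure \<Omega> - ball x0 r \<and> x \<in> cball x0 r
          \<longrightarrow> max (u x) (\<psi> x) = u x"
      proof (intro allI impI)
        fix x assume "x \<in> cball x0 r \<and> x \<notin> cball x0 r \<or> x \<in> closure \<Omega> - ball x0 r \<and> x \<in> cball x0 r"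
        then have "dist x0 x = r" by auto
        from \<psi>_sphere[OF this] show "max (u x) (\<psi> x) = u x" by simp
      qed
    qed (auto intro: closed_Diff)
    moreover have "cball x0 r \<union> (closure \<Omega> - ball x0 r) = closure \<Omega>"
      using clos ball_subset_cball[of x0 r] by blast
    ultimately show ?thesis
      unfolding v_def by simp
  qed
  have v_conv: "convex_on (closure \<Omega>) v"
  proof (rule convex_onI)
    fix t :: real and a b assume t: "0 < t" "t < 1" and ab: "a \<in> closure \<Omega>" "b \<in> closure \<Omega>"
    define z where "z = (1 - t) *\<^sub>R a + t *\<^sub>R b"
    have "v z \<le> (1 - t) * v a + t * v b"
      using v_cases[of z]
    proof
      assume "v z = u z"
      also have "u z \<le> (1 - t) * u a + t * u b"
        unfolding z_def using t ab by (intro convex_onD[OF u_conv]) auto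
      also have "\<dots> \<le> (1 - t) * v a + t * v b"
        using t u_le_v by (intro add_mono mult_left_mono) auto
      finally show ?thesis .
    next
      assume z: "z \<in> ball x0 r \<and> v z = \<psi> z \<and> u z < \<psi> z"
      \<comment> \<open>The tangent plane at \<open>z\<close> is affine, so its weighted mean over
        \<open>a\<close> and \<open>b\<close> is \<open>\<psi> z\<close>.\<close>
      have "(1 - t) *\<^sub>R (a - z) + t *\<^sub>R (b - z) = 0"
        by (simp add: z_def algebra_simps)
      from arg_cong[OF this, of "\<lambda>y. gradient \<psi> z \<bullet> y"]
      have "v z = (1 - t) * (\<psi> z + gradient \<psi> z \<bullet> (a - z)) + t * (\<psi> z + gradient \<psi> z \<bullet> (b - z))"
        using z by (simp add: inner_add_right algebra_simps)
      also have "\<dots> \<le> (1 - t) * v a + t * v b"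
        using t z ab by (intro add_mono mult_left_mono above_tangent) auto
      finally show ?thesis .
    qed
    then show "v ((1 - t) *\<^sub>R a + t *\<^sub>R b) \<le> (1 - t) * v a + t * v b"
      by (simp add: z_def)
  qed (simp add: convex_domain convex_closure)
  have v_neg: "v x < 0" if "x \<in> \<Omega>" for x
    using v_cases[of x] u_neg[OF that] \<psi>_le[of x] e_neg by auto
  have v_cand: "viscosity_candidate \<Omega> v"
    using v_cont v_conv v_neg by (simp add: viscosity_candidate_def)
  \<comment> \<open>Where \<open>v = u\<close>, contact with \<open>v\<close> from above is also
    contact with \<open>u\<close>, as \<open>u \<le> v\<close>. Elsewhere \<eta> touches \<psi>: the
    gradients agree, the Hessian of \<eta> dominates, and \<open>det_mono_pd\<close> transfers the
    strict inequality of \<psi>.\<close>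
  have "f x1 (v x1) (gradient \<eta> x1) \<le> det (hessian \<eta> x1)"
    if "x1 \<in> \<Omega>" "open V" "x1 \<in> V" and C2\<eta>: "C2_on (V \<inter> \<Omega>) \<eta>" and conv\<eta>: "convex_fun_on (V \<inter> \<Omega>) \<eta>"
      and min: "\<And>x. x \<in> V \<inter> \<Omega> \<Longrightarrow> \<eta> x1 - v x1 \<le> \<eta> x - v x" for x1 V \<eta>
    using v_cases[of x1]
  proof
    assume eq: "v x1 = u x1"
    have "\<eta> x1 - u x1 \<le> \<eta> y - u y" if "y \<in> V \<inter> \<Omega>" for y
      using min[OF that] eq u_le_v[of y] by simp
    then show ?thesis
      unfolding eq using \<open>x1 \<in> \<Omega>\<close> \<open>x1 \<in> V\<close>
      by (intro subsolution_test[OF sub _ _ C2\<eta> conv\<eta>]) auto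
  next
    assume x1: "x1 \<in> ball x0 r \<and> v x1 = \<psi> x1 \<and> u x1 < \<psi> x1"
    then have "x1 \<in> cball x0 r"
      by simp
    then have x1R: "x1 \<in> ball x0 R" "x1 \<in> W" "x1 \<in> cball x0 r"
      using r(2) rW by blast+
    have "open (ball x0 r \<inter> (V \<inter> \<Omega>))" "x1 \<in> ball x0 r \<inter> (V \<inter> \<Omega>)"
      using x1 that open_domain by auto
    then obtain s where s: "0 < s" "ball x1 s \<subseteq> ball x0 r \<inter> (V \<inter> \<Omega>)"
      by (meson openE)
    have inW: "x \<in> W" if "x \<in> ball x1 s" for x
      using that s(2) rW by force
    have min\<psi>: "\<eta> x1 - \<psi> x1 \<le> \<eta> y - \<psi> y" if "y \<in> ball x1 s" for y
    proof -
      have "y \<in> V \<inter> \<Omega>" "y \<in> ball x0 r"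
        using that s(2) by auto
      then have "\<psi> y \<le> v y"
        by (simp add: v_def)
      then show ?thesis
        using min[OF \<open>y \<in> V \<inter> \<Omega>\<close>] x1 by simp
    qed
    note touch = touching_from_above[of "V \<inter> \<Omega>" \<eta> x1 s \<psi>
        "\<lambda>\<xi> s. gradient \<psi> (x1 + s *\<^sub>R \<xi>) \<bullet> \<xi>" "\<lambda>\<xi>. \<xi> \<bullet> (hessian \<psi> x1 *v \<xi>)", OF C2\<eta> _ s(1)]
    have d1: "((\<lambda>s. \<psi> (x1 + s *\<^sub>R \<xi>)) has_real_derivative gradient \<psi> (x1 + t *\<^sub>R \<xi>) \<bullet> \<xi>) (at t)"
      if "x1 + t *\<^sub>R \<xi> \<in> ball x1 s" for \<xi> t
      by (rule has_real_derivative_line_gradient[OF C2\<psi>(1) inW[OF that]])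
    have d2: "((\<lambda>s. gradient \<psi> (x1 + s *\<^sub>R \<xi>) \<bullet> \<xi>) has_real_derivative \<xi> \<bullet> (hessian \<psi> x1 *v \<xi>)) (at 0)" for \<xi>
      using has_real_derivative_line_hessian[OF C2\<psi>(1), of x1 0 \<xi> \<xi>] x1R(2) by simp
    have "gradient \<eta> x1 \<bullet> \<xi> = gradient \<psi> x1 \<bullet> \<xi>" for \<xi>
      using touch(1)[OF _ _ d1 d2 min\<psi>, of \<xi>] s(2) that by auto
    then have grad: "gradient \<eta> x1 = gradient \<psi> x1"
      by (meson vector_eq_rdot)
    have hess: "\<xi> \<bullet> (hessian \<psi> x1 *v \<xi>) \<le> \<xi> \<bullet> (hessian \<eta> x1 *v \<xi>)" for \<xi>
      using touch(2)[OF _ _ d1 d2 min\<psi>, of \<xi>] s(2) that by auto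
    have "f x1 (v x1) (gradient \<eta> x1) \<le> f x1 (u x0 + e) (gradient \<psi> x1)"
      unfolding grad using x1 \<psi>_le[OF x1R(3)] e_neg that(1) by (intro rhs_mono) auto
    also have "\<dots> \<le> det (hessian \<psi> x1)"
      unfolding C2\<psi>(2,3)[OF x1R(2)] using bspec[OF r1(3), of x1] R(3)[OF x1R(1)] by simp
    also have "\<dots> \<le> det (hessian \<eta> x1)"
      using that by (intro det_mono_pd hess pd0[OF x1R(1)] hessian_symmetric[OF C2\<eta>]
          hessian_symmetric[OF C2\<psi>(1) x1R(2)]) auto
    finally show ?thesis .
  qed
  then have "viscosity_subsolution f \<Omega> v"
    using v_cand unfolding viscosity_subsolution_def by blast
  moreover have "u x0 < v x0"
    using r(1) \<delta>(1) by (simp add: v_def \<psi>_def)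
  ultimately show thesis
    using u_le_v x0(1) that by blast
qed

text \<open>With a floor \<open>- M\<close> common to all barriers, the barriers are members of the
  family: each pins the supremum to 0 at its own point. A bump only raises the supremum, so it stays
  in the family as well.\<close>

theorem perron:
  assumes barrier: "\<And>y. y \<in> frontier \<Omega> \<Longrightarrow>
      \<exists>w. viscosity_subsolution f \<Omega> w \<and> (\<forall>x\<in>closure \<Omega>. - M \<le> w x) \<and> w y = 0"
    and "frontier \<Omega> \<noteq> {}"
  shows "\<exists>u. dirichlet_viscosity_solution f \<Omega> u"
proof -
  define \<S> where "\<S> = {v. viscosity_subsolution f \<Omega> v \<and> (\<forall>x\<in>closure \<Omega>. - M \<le> v x)}"
  define u where "u x = (SUP v\<in>\<S>. v x)" for x
  have "\<S> \<noteq> {}"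
    using assms by (auto simp: \<S>_def)
  have v_cand: "viscosity_candidate \<Omega> v" if "v \<in> \<S>" for v
    using that by (simp add: \<S>_def viscosity_subsolution_def)
  have v_nonpos: "v x \<le> 0" if "v \<in> \<S>" "x \<in> closure \<Omega>" for v x
    using viscosity_candidate_nonpos[OF v_cand] that .
  have bdd: "bdd_above ((\<lambda>v. v x) ` \<S>)" if "x \<in> closure \<Omega>" for x
    using v_nonpos that by (auto intro!: bdd_aboveI)
  have v_le: "v x \<le> u x" if "v \<in> \<S>" "x \<in> closure \<Omega>" for v x
    unfolding u_def using bdd[OF that(2)] that(1) by (intro cSUP_upper)
  have u_le: "u x \<le> c" if "\<And>v. v \<in> \<S> \<Longrightarrow> v x \<le> c" for x c
    unfolding u_def using \<open>\<S> \<noteq> {}\<close> that by (intro cSUP_least)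
  have u_lower: "- M \<le> u x" if "x \<in> closure \<Omega>" for x
    using v_le[OF _ that] \<open>\<S> \<noteq> {}\<close> that unfolding \<S>_def by fastforce
  have u_conv: "convex_on (closure \<Omega>) u"
  proof (rule convex_onI)
    fix t :: real and x y assume t: "0 < t" "t < 1" and xy: "x \<in> closure \<Omega>" "y \<in> closure \<Omega>"
    show "u ((1 - t) *\<^sub>R x + t *\<^sub>R y) \<le> (1 - t) * u x + t * u y"
    proof (rule u_le)
      fix v assume "v \<in> \<S>"
      then have "convex_on (closure \<Omega>) v"
        using v_cand by (simp add: viscosity_candidate_def)
      then have "v ((1 - t) *\<^sub>R x + t *\<^sub>R y) \<le> (1 - t) * v x + t * v y"
        using t xy by (intro convex_onD) auto
      also have "\<dots> \<le> (1 - t) * u x + t * u y"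
        using t xy v_le[OF \<open>v \<in> \<S>\<close>] by (intro add_mono mult_left_mono) auto
      finally show "v ((1 - t) *\<^sub>R x + t *\<^sub>R y) \<le> (1 - t) * u x + t * u y" .
    qed
  qed (simp add: convex_domain convex_closure)
  \<comment> \<open>Negativity of the members alone does not pass to the supremum; their uniform
    bound \<open>c\<close> at \<open>x\<close> does.\<close>
  have u_neg: "u x < 0" if "x \<in> \<Omega>" for x
  proof -
    note subsolutions_uniformly_negative[OF that, of M]
    then obtain c where "c < 0"
      "\<And>v. viscosity_subsolution f \<Omega> v \<Longrightarrow> (\<forall>x\<in>\<Omega>. - M \<le> v x) \<Longrightarrow> v x \<le> c"
      by blast
    moreover from this have "u x \<le> c"
      using closure_subset by (intro u_le) (auto simp: \<S>_def)
    ultimately show ?thesis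
      by simp
  qed
  have u_nonpos: "u x \<le> 0" if "x \<in> closure \<Omega>" for x
    using v_nonpos that by (intro u_le) auto
  obtain w where w: "\<And>y. y \<in> frontier \<Omega> \<Longrightarrow> w y \<in> \<S>" "\<And>y. y \<in> frontier \<Omega> \<Longrightarrow> w y y = 0"
    using barrier unfolding \<S>_def mem_Collect_eq by metis
  have u_frontier: "u y = 0" if "y \<in> frontier \<Omega>" for y
  proof -
    have "y \<in> closure \<Omega>"
      using that by (simp add: frontier_def)
    then show ?thesis
      using v_le[OF w(1)[OF that]] w(2)[OF that] u_nonpos by force
  qed
  have u_cont: "continuous_on (closure \<Omega>) u"
    unfolding continuous_on_eq_continuous_within
  proof
    fix y assume "y \<in> closure \<Omega>"
    show "continuous (at y within closure \<Omega>) u"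
    proof (cases "y \<in> \<Omega>")
      case True
      have "continuous_on \<Omega> u"
        using u_conv closure_subset convex_domain
        by (intro convex_on_continuous open_domain) (auto intro: convex_on_subset)
      then have "isCont u y"
        using True open_domain by (simp add: continuous_on_eq_continuous_at)
      then show ?thesis
        by (rule continuous_at_imp_continuous_at_within)
    next
      case False
      then have y: "y \<in> frontier \<Omega>"
        using \<open>y \<in> closure \<Omega>\<close> open_domain by (simp add: frontier_def interior_open)
      have "(w y \<longlongrightarrow> w y y) (at y within closure \<Omega>)"
        using v_cand[OF w(1)[OF y]] \<open>y \<in> closure \<Omega>\<close>
        by (simp add: viscosity_candidate_def continuous_on_def)
      then have "(w y \<longlongrightarrow> 0) (at y within closure \<Omega>)"
        by (simp add: w(2)[OF y])
      \<comment> \<open>Squeezed between the barrier at \<open>y\<close> and 0.\<close>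
      then have "(u \<longlongrightarrow> 0) (at y within closure \<Omega>)"
        by (rule tendsto_sandwich[rotated 2, OF _ tendsto_const])
          (auto simp: eventually_at_filter intro!: always_eventually v_le[OF w(1)[OF y]] u_nonpos)
      then show ?thesis
        by (simp add: continuous_within u_frontier[OF y])
    qed
  qed
  have "viscosity_candidate \<Omega> u"
    using u_cont u_conv u_neg by (simp add: viscosity_candidate_def)
  then have u_sub: "viscosity_subsolution f \<Omega> u"
    using viscosity_subsolution_SUP[OF \<open>\<S> \<noteq> {}\<close>] unfolding u_def by (simp add: \<S>_def)
  moreover have "viscosity_supersolution f \<Omega> u"
  proof (rule ccontr)
    assume "\<not> viscosity_supersolution f \<Omega> u"
    with u_sub obtain v x0 where v: "viscosity_subsolution f \<Omega> v" "\<And>x. u x \<le> v x"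
      and x0: "x0 \<in> \<Omega>" "u x0 < v x0"
      by (rule subsolution_bump) blast
    then have "v \<in> \<S>"
      using u_lower order_trans unfolding \<S>_def by blast
    then have "v x0 \<le> u x0"
      using x0(1) closure_subset by (intro v_le) auto
    then show False
      using x0(2) by simp
  qed
  ultimately show ?thesis
    using u_frontier unfolding dirichlet_viscosity_solution_def viscosity_solution_def by blast
qed

end

section \<open>Barriers at boundary points\<close>

text \<open>The convexity defect is continuous on pairs of points of the closure and nonnegative on
  a dense set of pairs. This allows the barrier to be differentiated only inside \<Omega>, since its
  derivatives may blow up at the boundary.\<close>

lemma convex_on_closure:
  fixes w :: "'a::real_normed_vector \<Rightarrow> real"
  assumes conv: "convex_on S w" and cont: "continuous_on (closure S) w"
  shows "convex_on (closure S) w"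
proof (rule convex_onI)
  have "convex S"
    using conv by (rule convex_on_imp_convex)
  then show clos: "convex (closure S)"
    by (rule convex_closure)
  fix t :: real and a b
  assume t: "0 < t" "t < 1" and ab: "a \<in> closure S" "b \<in> closure S"
  define h where "h p = (1 - t) * w (fst p) + t * w (snd p) - w ((1 - t) *\<^sub>R fst p + t *\<^sub>R snd p)" for p
  have mem: "(1 - t) *\<^sub>R x + t *\<^sub>R y \<in> closure S" if "x \<in> closure S" "y \<in> closure S" for x y
    using that t by (intro convexD_alt[OF clos]) auto
  have "continuous_on (closure (S \<times> S)) h"
  proof -
    note comp = continuous_on_compose2[OF cont, of "closure S \<times> closure S"]
    have "continuous_on (closure S \<times> closure S) (\<lambda>p. w (fst p))"
      "continuous_on (closure S \<times> closure S) (\<lambda>p. w (snd p))"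
      by (rule comp; auto intro: continuous_intros)+
    moreover have "continuous_on (closure S \<times> closure S) (\<lambda>p. w ((1 - t) *\<^sub>R fst p + t *\<^sub>R snd p))"
    proof (rule comp)
      show "continuous_on (closure S \<times> closure S) (\<lambda>p. (1 - t) *\<^sub>R fst p + t *\<^sub>R snd p)"
        by (intro continuous_intros)
      show "(\<lambda>p. (1 - t) *\<^sub>R fst p + t *\<^sub>R snd p) ` (closure S \<times> closure S) \<subseteq> closure S"
        using mem by auto
    qed
    ultimately show ?thesis
      unfolding h_def closure_Times by (intro continuous_intros)
  qed
  moreover have "0 \<le> h p" if "p \<in> S \<times> S" for p
  proof -
    have "w ((1 - t) *\<^sub>R fst p + t *\<^sub>R snd p) \<le> (1 - t) * w (fst p) + t * w (snd p)"
      using that t by (intro convex_onD[OF conv]) auto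
    then show ?thesis
      by (simp add: h_def)
  qed
  ultimately have "0 \<le> h (a, b)"
    using continuous_ge_on_closure[of "S \<times> S" h "(a, b)" 0] ab by (simp add: closure_Times)
  then show "w ((1 - t) *\<^sub>R a + t *\<^sub>R b) \<le> (1 - t) * w a + t * w b"
    by (simp add: h_def)
qed

text \<open>The signs of \<alpha> and \<gamma> are not prescribed, so factors between 1 and a known
  bound are estimated with the absolute value of the exponent.\<close>

lemma powr_le_powr_abs_exponent:
  fixes c N p :: real
  assumes "1 \<le> c" "c \<le> N"
  shows "c powr p \<le> N powr \<bar>p\<bar>"
proof -
  have "c powr p \<le> c powr \<bar>p\<bar>"
    using assms by (intro powr_mono) auto
  also have "\<dots> \<le> N powr \<bar>p\<bar>"
    using assms by (intro powr_mono2) auto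
  finally show ?thesis .
qed

lemma has_real_derivative_powr_affine:
  fixes \<tau> \<sigma> a s :: real
  assumes "0 < \<tau> + s * \<sigma>"
  shows "((\<lambda>s. (\<tau> + s * \<sigma>) powr a) has_real_derivative a * \<sigma> * (\<tau> + s * \<sigma>) powr (a - 1)) (at s)"
  using assms by (auto intro!: derivative_eq_intros DERIV_fun_powr[THEN DERIV_cong])

text \<open>For small \<open>a\<close> the exponent of \<open>T\<close> on the left exceeds the one on the right,
  and the exponent of \<open>K\<close> on the left is smaller than the one on the right.\<close>

lemma barrier_growth:
  fixes T R K N L a A d \<alpha> \<beta> \<gamma> c g :: real and n :: nat
  defines "\<kappa> \<equiv> real n + \<alpha> - \<gamma>"
  assumes T: "0 < T" "T \<le> R" and "1 \<le> R" "0 < a" "a < 1" "1 \<le> K" "0 < A" "1 \<le> n"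
    and d: "0 < d" "d \<le> T" and \<beta>: "real n + 1 \<le> \<beta>"
    and c: "1 \<le> c" "c \<le> N"
    and g: "K * T powr (a - 1) \<le> g" "g \<le> K * T powr (a - 1) * L"
    and \<theta>: "a * \<kappa> \<le> \<beta> - real n + 1 - \<gamma>"
    and K: "A * N powr \<bar>\<alpha>\<bar> * (R\<^sup>2 + L\<^sup>2) powr \<bar>\<gamma> / 2\<bar> * R powr (\<beta> - real n + 1 - \<gamma> - a * \<kappa>) \<le> K powr \<kappa>"
  shows "A * d powr (\<beta> - real n - 1) * (K * T powr a * c) powr (- \<alpha>) * (1 + g\<^sup>2) powr (\<gamma> / 2)
    \<le> (K * T powr (a - 2)) * (K * T powr a) ^ (n - 1)"
proof -
  \<comment> \<open>The surplus power of \<open>T\<close> in the bound for \<open>f\<close> over the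
    power \<open>T powr (real n * a - 2)\<close> of the determinant bound.\<close>
  define \<theta>' where "\<theta>' = \<beta> - real n + 1 - \<gamma> - a * \<kappa>"
  \<comment> \<open>Up to bounded factors, \<open>Z\<close> is the size of the gradient and
    \<open>V\<close> that of the barrier.\<close>
  define Z where "Z = K * T powr (a - 1)"
  define V where "V = K * T powr a"
  have pos: "0 < Z" "0 < V" "0 < K"
    using T \<open>1 \<le> K\<close> by (auto simp: Z_def V_def)
  have d': "d powr (\<beta> - real n - 1) \<le> T powr (\<beta> - real n - 1)"
    using d \<beta> by (intro powr_mono2) auto
  have w: "(V * c) powr (- \<alpha>) \<le> V powr (- \<alpha>) * N powr \<bar>\<alpha>\<bar>"
    using powr_le_powr_abs_exponent[OF c, of "- \<alpha>"] pos c
    by (simp add: powr_mult mult_left_mono)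
  \<comment> \<open>As \<open>T \<le> R\<close>, the gradient scale is bounded below; this absorbs
    the 1 in \<open>1 + g\<^sup>2\<close>.\<close>
  have "1 \<le> Z * R"
  proof -
    have "1 \<le> R powr a"
      using \<open>1 \<le> R\<close> \<open>0 < a\<close> by (simp add: ge_one_powr_ge_zero)
    also have "R powr a = R powr (a - 1) * R"
      using \<open>1 \<le> R\<close> by (simp add: powr_diff)
    also have "\<dots> \<le> T powr (a - 1) * R"
      using T \<open>1 \<le> R\<close> \<open>a < 1\<close> by (intro mult_right_mono powr_mono2') auto
    also have "\<dots> \<le> K * (T powr (a - 1) * R)"
      using mult_right_mono[OF \<open>1 \<le> K\<close>, of "T powr (a - 1) * R"] \<open>1 \<le> R\<close> by simp
    finally show ?thesis
      by (simp add: Z_def mult.assoc)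
  qed
  then have "1 \<le> (Z * R)\<^sup>2"
    by (simp add: one_le_power)
  moreover have "g\<^sup>2 \<le> (Z * L)\<^sup>2"
    using g pos by (intro power_mono) (auto simp: Z_def)
  ultimately have upper: "1 + g\<^sup>2 \<le> Z\<^sup>2 * (R\<^sup>2 + L\<^sup>2)"
    by (simp add: power_mult_distrib algebra_simps)
  have lower: "Z\<^sup>2 \<le> 1 + g\<^sup>2"
  proof -
    have "Z\<^sup>2 \<le> g\<^sup>2"
      using g(1) pos by (intro power_mono) (auto simp: Z_def)
    then show ?thesis
      by simp
  qed
  \<comment> \<open>With \<open>1 + g\<^sup>2 = Z\<^sup>2 * c'\<close> and \<open>c'\<close> between
    1 and \<open>R\<^sup>2 + L\<^sup>2\<close>, both signs of \<gamma> are treated at once.\<close>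
  define c' where "c' = (1 + g\<^sup>2) / Z\<^sup>2"
  have c': "1 \<le> c'" "c' \<le> R\<^sup>2 + L\<^sup>2"
    using upper lower pos by (auto simp: c'_def field_simps)
  have "(1 + g\<^sup>2) powr (\<gamma> / 2) = (Z\<^sup>2 * c') powr (\<gamma> / 2)"
    using pos by (simp add: c'_def)
  also have "\<dots> = Z powr \<gamma> * c' powr (\<gamma> / 2)"
    using pos c' by (simp add: powr_mult powr_powr flip: powr_numeral)
  also have "\<dots> \<le> Z powr \<gamma> * (R\<^sup>2 + L\<^sup>2) powr \<bar>\<gamma> / 2\<bar>"
    by (intro mult_left_mono powr_le_powr_abs_exponent[OF c']) auto
  finally have q: "(1 + g\<^sup>2) powr (\<gamma> / 2) \<le> Z powr \<gamma> * (R\<^sup>2 + L\<^sup>2) powr \<bar>\<gamma> / 2\<bar>" .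
  have "A * d powr (\<beta> - real n - 1) * (V * c) powr (- \<alpha>) * (1 + g\<^sup>2) powr (\<gamma> / 2)
    \<le> A * T powr (\<beta> - real n - 1) * (V powr (- \<alpha>) * N powr \<bar>\<alpha>\<bar>)
      * (Z powr \<gamma> * (R\<^sup>2 + L\<^sup>2) powr \<bar>\<gamma> / 2\<bar>)"
  proof (intro mult_mono)
    show "(1 + g\<^sup>2) powr (\<gamma> / 2) \<le> Z powr \<gamma> * (R\<^sup>2 + L\<^sup>2) powr \<bar>\<gamma> / 2\<bar>" by (rule q)
    show "(V * c) powr (- \<alpha>) \<le> V powr (- \<alpha>) * N powr \<bar>\<alpha>\<bar>" by (rule w)
    show "d powr (\<beta> - real n - 1) \<le> T powr (\<beta> - real n - 1)" by (rule d')
  qed (use \<open>0 < A\<close> in simp_all)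
  also have "\<dots> = (A * N powr \<bar>\<alpha>\<bar> * (R\<^sup>2 + L\<^sup>2) powr \<bar>\<gamma> / 2\<bar>)
      * (T powr (\<beta> - real n - 1) * V powr (- \<alpha>) * Z powr \<gamma>)"
    by (simp only: ac_simps)
  also have "T powr (\<beta> - real n - 1) * V powr (- \<alpha>) * Z powr \<gamma>
      = K powr (real n - \<kappa>) * T powr (real n * a - 2 + \<theta>')"
  proof -
    have "T powr (\<beta> - real n - 1) * V powr (- \<alpha>) * Z powr \<gamma>
        = K powr (- \<alpha> + \<gamma>) * T powr ((\<beta> - real n - 1) + a * (- \<alpha>) + (a - 1) * \<gamma>)"
    proof -
      have "V powr (- \<alpha>) = K powr (- \<alpha>) * T powr (a * (- \<alpha>))"
        "Z powr \<gamma> = K powr \<gamma> * T powr ((a - 1) * \<gamma>)"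
        using pos T by (simp_all add: V_def Z_def powr_mult powr_powr)
      then show ?thesis
        by (simp only: powr_add ac_simps)
    qed
    also have "- \<alpha> + \<gamma> = real n - \<kappa>"
      by (simp add: \<kappa>_def)
    also have "(\<beta> - real n - 1) + a * (- \<alpha>) + (a - 1) * \<gamma> = real n * a - 2 + \<theta>'"
      by (simp add: \<theta>'_def \<kappa>_def algebra_simps)
    finally show ?thesis .
  qed
  also have "(A * N powr \<bar>\<alpha>\<bar> * (R\<^sup>2 + L\<^sup>2) powr \<bar>\<gamma> / 2\<bar>)
        * (K powr (real n - \<kappa>) * T powr (real n * a - 2 + \<theta>'))
      = (A * N powr \<bar>\<alpha>\<bar> * (R\<^sup>2 + L\<^sup>2) powr \<bar>\<gamma> / 2\<bar> * T powr \<theta>')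
        * (K powr (real n - \<kappa>) * T powr (real n * a - 2))"
    by (simp add: powr_add)
  also have "\<dots> \<le> K powr \<kappa> * (K powr (real n - \<kappa>) * T powr (real n * a - 2))"
  proof (intro mult_right_mono)
    have "T powr \<theta>' \<le> R powr \<theta>'"
      using T \<theta> by (intro powr_mono2) (auto simp: \<theta>'_def)
    then have "A * N powr \<bar>\<alpha>\<bar> * (R\<^sup>2 + L\<^sup>2) powr \<bar>\<gamma> / 2\<bar> * T powr \<theta>'
        \<le> A * N powr \<bar>\<alpha>\<bar> * (R\<^sup>2 + L\<^sup>2) powr \<bar>\<gamma> / 2\<bar> * R powr \<theta>'"
      using \<open>0 < A\<close> by (intro mult_left_mono) auto
    also note K[folded \<theta>'_def]
    finally show "A * N powr \<bar>\<alpha>\<bar> * (R\<^sup>2 + L\<^sup>2) powr \<bar>\<gamma> / 2\<bar> * T powr \<theta>' \<le> K powr \<kappa>" .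
  qed auto
  also have "\<dots> = K powr (real n) * T powr (real n * a - 2)"
    using pos by (simp add: powr_diff)
  also have "\<dots> = (K * T powr (a - 2)) * V ^ (n - 1)"
  proof -
    have "V ^ (n - 1) = V powr (real n - 1)"
      using pos \<open>1 \<le> n\<close> by (simp add: of_nat_diff flip: powr_realpow)
    also have "\<dots> = K powr (real n - 1) * T powr (a * (real n - 1))"
      using pos T by (simp add: V_def powr_mult powr_powr)
    finally have "(K * T powr (a - 2)) * V ^ (n - 1)
        = (K powr 1 * K powr (real n - 1)) * (T powr (a - 2) * T powr (a * (real n - 1)))"
      using pos by simp
    also have "\<dots> = K powr (real n) * T powr (real n * a - 2)"
    proof -
      have "1 + (real n - 1) = real n" "(a - 2) + a * (real n - 1) = real n * a - 2"
        by (simp_all add: algebra_simps)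
      then show ?thesis
        by (simp only: powr_add[symmetric])
    qed
    finally show ?thesis ..
  qed
  finally show ?thesis
    by (simp add: V_def)
qed

text \<open>After \<open>T powr (a - 2)\<close> is factored out, the mixed term is absorbed by the
  square \<open>(2 * a * R * \<sigma> + T * (p / R))\<^sup>2\<close>. This costs one of the two
  copies of \<open>T\<^sup>2 * C\<close> and the part \<open>4 * a\<^sup>2 * R\<^sup>2\<close> of
  the normal curvature; the summand 1 in the condition on \<open>N\<close> is what remains as the
  coefficient of \<open>\<sigma>\<^sup>2\<close>.\<close>

lemma halfspace_barrier_second_derivative_bound:
  fixes T Q p C \<sigma> K N R a :: real
  assumes "0 < T" "Q \<le> R\<^sup>2" "p\<^sup>2 \<le> R\<^sup>2 * C" "0 < a" "a < 1" "0 \<le> K"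
    and N: "4 * a\<^sup>2 * R\<^sup>2 + 1 \<le> a * (1 - a) * (N - R\<^sup>2)" and "0 < R"
  shows "K * T powr a * C + K * T powr (a - 2) * \<sigma>\<^sup>2
    \<le> K * (a * (a - 1) * \<sigma>\<^sup>2 * T powr (a - 2) * (Q - N) + 4 * a * \<sigma> * T powr (a - 1) * p
        + 2 * T powr a * C)"
proof -
  have T1: "T powr (a - 1) = T powr (a - 2) * T" and T2: "T powr a = T powr (a - 2) * T\<^sup>2"
    using \<open>0 < T\<close> powr_add[of T "a - 2" 1] powr_add[of T "a - 2" 2] by (simp_all add: algebra_simps)
  have "p\<^sup>2 / R\<^sup>2 \<le> C"
    using assms(3) \<open>0 < R\<close> by (simp add: pos_divide_le_eq mult.commute)
  then have "T\<^sup>2 * (p\<^sup>2 / R\<^sup>2) \<le> T\<^sup>2 * C"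
    by (intro mult_left_mono) auto
  moreover have "0 \<le> (2 * a * R * \<sigma> + T * (p / R))\<^sup>2"
    by simp
  then have "0 \<le> 4 * a\<^sup>2 * R\<^sup>2 * \<sigma>\<^sup>2 + 4 * a * \<sigma> * T * p + T\<^sup>2 * (p\<^sup>2 / R\<^sup>2)"
    using \<open>0 < R\<close> by (simp add: power2_sum power_mult_distrib power_divide)
  moreover have "(4 * a\<^sup>2 * R\<^sup>2 + 1) * \<sigma>\<^sup>2 \<le> (a * (1 - a) * (N - Q)) * \<sigma>\<^sup>2"
  proof (intro mult_right_mono)
    have "a * (1 - a) * (N - R\<^sup>2) \<le> a * (1 - a) * (N - Q)"
      using assms by (intro mult_left_mono) auto
    with N show "4 * a\<^sup>2 * R\<^sup>2 + 1 \<le> a * (1 - a) * (N - Q)"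
      by simp
  qed simp
  ultimately have "T\<^sup>2 * C + \<sigma>\<^sup>2 \<le> (a * (1 - a) * (N - Q)) * \<sigma>\<^sup>2 + 4 * a * \<sigma> * T * p + 2 * (T\<^sup>2 * C)"
    by (simp add: algebra_simps)
  then have "K * T powr (a - 2) * (T\<^sup>2 * C + \<sigma>\<^sup>2)
      \<le> K * T powr (a - 2) * ((a * (1 - a) * (N - Q)) * \<sigma>\<^sup>2 + 4 * a * \<sigma> * T * p + 2 * (T\<^sup>2 * C))"
    using \<open>0 \<le> K\<close> by (intro mult_left_mono) auto
  also have "\<dots> = K * (a * (a - 1) * \<sigma>\<^sup>2 * T powr (a - 2) * (Q - N)
      + 4 * a * \<sigma> * (T powr (a - 2) * T) * p + 2 * (T powr (a - 2) * T\<^sup>2) * C)"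
    by algebra
  finally show ?thesis
    unfolding T1 T2 by (simp only: distrib_left mult.assoc)
qed

section \<open>The barrier of a supporting half-space\<close>

definition halfspace_barrier :: "real \<Rightarrow> real \<Rightarrow> real \<Rightarrow> real^'n \<Rightarrow> real^'n \<Rightarrow> real^'n \<Rightarrow> real" where
  "halfspace_barrier K a N e y x = K * (e \<bullet> (x - y)) powr a * ((norm (x - y))\<^sup>2 - N)"

definition halfspace_barrier_D1 ::
  "real \<Rightarrow> real \<Rightarrow> real \<Rightarrow> real^'n \<Rightarrow> real^'n \<Rightarrow> real^'n \<Rightarrow> real^'n \<Rightarrow> real" where
  "halfspace_barrier_D1 K a N e y x \<xi> = K * (a * (e \<bullet> \<xi>) * (e \<bullet> (x - y)) powr (a - 1) * ((norm (x - y))\<^sup>2 - N)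
    + 2 * (e \<bullet> (x - y)) powr a * ((x - y) \<bullet> \<xi>))"

definition halfspace_barrier_D2 ::
  "real \<Rightarrow> real \<Rightarrow> real \<Rightarrow> real^'n \<Rightarrow> real^'n \<Rightarrow> real^'n \<Rightarrow> real^'n \<Rightarrow> real" where
  "halfspace_barrier_D2 K a N e y x \<xi> =
    K * (a * (a - 1) * (e \<bullet> \<xi>)\<^sup>2 * (e \<bullet> (x - y)) powr (a - 2) * ((norm (x - y))\<^sup>2 - N)
      + 4 * a * (e \<bullet> \<xi>) * (e \<bullet> (x - y)) powr (a - 1) * ((x - y) \<bullet> \<xi>)
      + 2 * (e \<bullet> (x - y)) powr a * (\<xi> \<bullet> \<xi>))"

lemma halfspace_barrier_line_derivatives:
  assumes "0 < e \<bullet> (x + s *\<^sub>R \<xi> - y)"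
  shows "((\<lambda>s. halfspace_barrier K a N e y (x + s *\<^sub>R \<xi>)) has_real_derivative
      halfspace_barrier_D1 K a N e y (x + s *\<^sub>R \<xi>) \<xi>) (at s)"
    and "((\<lambda>s. halfspace_barrier_D1 K a N e y (x + s *\<^sub>R \<xi>) \<xi>) has_real_derivative
      halfspace_barrier_D2 K a N e y (x + s *\<^sub>R \<xi>) \<xi>) (at s)"
proof -
  \<comment> \<open>Along the line, the distance to the hyperplane is affine in \<open>s\<close> and
    the squared distance to \<open>y\<close> is quadratic, with these coefficients.\<close>
  define \<tau> \<sigma> B C P where "\<tau> = e \<bullet> (x - y)" and "\<sigma> = e \<bullet> \<xi>" and "B = (x - y) \<bullet> \<xi>" and "C = \<xi> \<bullet> \<xi>"
    and "P = (norm (x - y))\<^sup>2"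
  have T: "e \<bullet> (x + s *\<^sub>R \<xi> - y) = \<tau> + s * \<sigma>" for s
    by (simp add: \<tau>_def \<sigma>_def inner_add_right inner_diff_right)
  have p: "(x + s *\<^sub>R \<xi> - y) \<bullet> \<xi> = B + s * C" for s
    by (simp add: B_def C_def inner_add_left inner_diff_left)
  have q: "(norm (x + s *\<^sub>R \<xi> - y))\<^sup>2 = P + 2 * B * s + C * s\<^sup>2" for s
    unfolding P_def B_def C_def power2_norm_eq_inner
    by (simp add: inner_add_left inner_diff_left inner_add_right inner_diff_right inner_commute
        algebra_simps power2_eq_square)
  have pos: "0 < \<tau> + s * \<sigma>"
    using assms T by simp
  note D = has_real_derivative_powr_affine[OF pos]
  have Dq: "((\<lambda>s. P + 2 * B * s + C * s\<^sup>2 - N) has_real_derivative 2 * (B + s * C)) (at s)"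
    by (auto intro!: derivative_eq_intros)
  have Dp: "((\<lambda>s. B + s * C) has_real_derivative C) (at s)"
    by (auto intro!: derivative_eq_intros)
  have exponent: "a - 1 - 1 = a - 2"
    by simp
  show "((\<lambda>s. halfspace_barrier K a N e y (x + s *\<^sub>R \<xi>)) has_real_derivative
      halfspace_barrier_D1 K a N e y (x + s *\<^sub>R \<xi>) \<xi>) (at s)"
    unfolding halfspace_barrier_def halfspace_barrier_D1_def T p q \<sigma>_def[symmetric]
    by (rule DERIV_cong[OF DERIV_mult[OF DERIV_cmult[OF D[of a], of K] Dq]]) algebra
  show "((\<lambda>s. halfspace_barrier_D1 K a N e y (x + s *\<^sub>R \<xi>) \<xi>) has_real_derivative
      halfspace_barrier_D2 K a N e y (x + s *\<^sub>R \<xi>) \<xi>) (at s)"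
    unfolding halfspace_barrier_D1_def halfspace_barrier_D2_def T p q \<sigma>_def[symmetric] C_def[symmetric]
    by (rule DERIV_cong[OF DERIV_cmult[OF DERIV_add[OF
              DERIV_mult[OF DERIV_cmult[OF D[of "a - 1"], of "a * \<sigma>"] Dq]
              DERIV_mult[OF DERIV_cmult[OF D[of a], of 2] Dp]], of K]])
      (simp only: exponent, simp add: algebra_simps power2_eq_square)
qed

text \<open>The segment from \<open>x\<close> to its foot on the hyperplane has length
  \<open>e \<bullet> (x - y)\<close> and ends outside \<Omega>, so it meets the boundary.\<close>

lemma infdist_frontier_le_hyperplane_distance:
  fixes \<Omega> :: "'a::euclidean_space set"
  assumes "norm e = 1" and halfspace: "\<And>x. x \<in> \<Omega> \<Longrightarrow> 0 < e \<bullet> (x - y)" and "x \<in> \<Omega>"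
  shows "infdist x (frontier \<Omega>) \<le> e \<bullet> (x - y)"
proof -
  define p where "p = x - (e \<bullet> (x - y)) *\<^sub>R e"
  have "e \<bullet> (p - y) = 0"
    using \<open>norm e = 1\<close> by (simp add: p_def inner_diff_right norm_eq_1)
  then have "p \<notin> \<Omega>"
    using halfspace by force
  then have "closed_segment x p \<inter> frontier \<Omega> \<noteq> {}"
    using \<open>x \<in> \<Omega>\<close> by (intro connected_Int_frontier) auto
  then obtain z where z: "z \<in> closed_segment x p" "z \<in> frontier \<Omega>"
    by blast
  have "infdist x (frontier \<Omega>) \<le> dist x z"
    by (rule infdist_le[OF z(2)])
  also have "\<dots> \<le> norm (p - x)"
    using segment_bound(1)[OF z(1)] by (simp add: dist_norm norm_minus_commute)
  also have "\<dots> = e \<bullet> (x - y)"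
    using \<open>norm e = 1\<close> halfspace[OF \<open>x \<in> \<Omega>\<close>] by (simp add: p_def)
  finally show ?thesis .
qed

text \<open>\<open>G\<close> is the gradient of the barrier. In units of
  \<open>K * T powr (a - 1)\<close>, the part along \<open>e\<close> is at least
  \<open>2 * R\<^sup>2 + 1\<close> by the condition on \<open>N\<close>, and the part along
  \<open>P\<close> at most \<open>2 * R\<^sup>2\<close>. Both bounds serve, as \<gamma> may have
  either sign.\<close>

lemma halfspace_barrier_gradient_bounds:
  fixes e P :: "real^'n"
  assumes "norm e = 1" "0 < T" "T \<le> R" "norm P \<le> R" "0 < a" "0 < K"
    and N: "2 * R\<^sup>2 + 1 \<le> a * (N - R\<^sup>2)"
  defines "G \<equiv> (K * (a * T powr (a - 1) * ((norm P)\<^sup>2 - N))) *\<^sub>R e + (K * (2 * T powr a)) *\<^sub>R P"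
  shows "K * T powr (a - 1) \<le> norm G" "norm G \<le> K * T powr (a - 1) * (a * N + 2 * R\<^sup>2)"
proof -
  define Z where "Z = K * T powr (a - 1)"
  have "0 < Z"
    using assms by (simp add: Z_def)
  have Q: "(norm P)\<^sup>2 \<le> R\<^sup>2"
    using \<open>norm P \<le> R\<close> by (intro power_mono) auto
  have "0 \<le> R\<^sup>2"
    by simp
  with N have "0 < a * (N - R\<^sup>2)"
    by linarith
  then have "R\<^sup>2 < N"
    using \<open>0 < a\<close> by (simp add: zero_less_mult_iff)
  have "norm ((K * (a * T powr (a - 1) * ((norm P)\<^sup>2 - N))) *\<^sub>R e)
      = \<bar>K * T powr (a - 1) * a * ((norm P)\<^sup>2 - N)\<bar>"
    using \<open>norm e = 1\<close> by (simp add: ac_simps)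
  also have "\<dots> = Z * (a * (N - (norm P)\<^sup>2))"
  proof -
    have "(norm P)\<^sup>2 - N < 0"
      using Q \<open>R\<^sup>2 < N\<close> by linarith
    then show ?thesis
      using \<open>0 < a\<close> \<open>0 < K\<close> by (simp add: Z_def abs_mult abs_of_neg)
  qed
  finally have normal: "norm ((K * (a * T powr (a - 1) * ((norm P)\<^sup>2 - N))) *\<^sub>R e) = Z * (a * (N - (norm P)\<^sup>2))" .
  have "norm ((K * (2 * T powr a)) *\<^sub>R P) = Z * (2 * (T * norm P))"
    using assms powr_add[of T "a - 1" 1] by (simp add: Z_def abs_mult)
  also have "\<dots> \<le> Z * (2 * (R * R))"
    using assms \<open>0 < Z\<close> by (intro mult_left_mono mult_mono) auto
  finally have tangential: "norm ((K * (2 * T powr a)) *\<^sub>R P) \<le> Z * (2 * R\<^sup>2)"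
    by (simp add: power2_eq_square)
  have "Z * 1 \<le> Z * (a * (N - (norm P)\<^sup>2) - 2 * R\<^sup>2)"
  proof (intro mult_left_mono)
    have "a * (N - R\<^sup>2) \<le> a * (N - (norm P)\<^sup>2)"
      using Q \<open>0 < a\<close> by (intro mult_left_mono) auto
    with N show "1 \<le> a * (N - (norm P)\<^sup>2) - 2 * R\<^sup>2"
      by simp
  qed (use \<open>0 < Z\<close> in simp)
  also have "\<dots> \<le> norm G"
    using norm_diff_ineq[of "(K * (a * T powr (a - 1) * ((norm P)\<^sup>2 - N))) *\<^sub>R e" "(K * (2 * T powr a)) *\<^sub>R P"]
      normal tangential unfolding G_def right_diff_distrib by linarith
  finally show "K * T powr (a - 1) \<le> norm G"
    by (simp add: Z_def)
  have "norm G \<le> Z * (a * (N - (norm P)\<^sup>2)) + Z * (2 * R\<^sup>2)"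
    using norm_triangle_ineq[of "(K * (a * T powr (a - 1) * ((norm P)\<^sup>2 - N))) *\<^sub>R e" "(K * (2 * T powr a)) *\<^sub>R P"]
      normal tangential unfolding G_def by linarith
  also have "\<dots> = Z * (a * (N - (norm P)\<^sup>2) + 2 * R\<^sup>2)"
    by (simp add: distrib_left)
  also have "\<dots> \<le> Z * (a * N + 2 * R\<^sup>2)"
    using \<open>0 < a\<close> \<open>0 < Z\<close> by (intro mult_left_mono add_right_mono) auto
  finally show "norm G \<le> K * T powr (a - 1) * (a * N + 2 * R\<^sup>2)"
    by (simp add: Z_def)
qed

text \<open>A test function touching the barrier from above has the same gradient and a larger
  Hessian at the contact point, so growth bound and determinant bound meet at explicit values. The
  floor in the second claim involves neither \<open>e\<close> nor \<open>y\<close>, hence serves all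
  boundary points.\<close>

lemma (in monge_ampere) viscosity_subsolution_halfspace_barrier:
  fixes A \<alpha> \<beta> \<gamma> K N R a :: real and e y :: "real^'n"
  defines "n \<equiv> real CARD('n)"
  defines "\<kappa> \<equiv> n + \<alpha> - \<gamma>" and "L \<equiv> a * N + 2 * R\<^sup>2"
  assumes growth: "\<And>x z q. x \<in> \<Omega> \<Longrightarrow> z < 0 \<Longrightarrow> f x z q \<le> A * infdist x (frontier \<Omega>) powr (\<beta> - n - 1)
        * \<bar>z\<bar> powr (- \<alpha>) * (1 + (norm q)\<^sup>2) powr (\<gamma> / 2)"
    and "0 < A" and \<beta>: "n + 1 \<le> \<beta>"
    and e: "norm e = 1" and halfspace: "\<And>x. x \<in> \<Omega> \<Longrightarrow> 0 < e \<bullet> (x - y)"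
    and diam: "\<And>x. x \<in> \<Omega> \<Longrightarrow> norm (x - y) \<le> R" and "1 \<le> R"
    and a: "0 < a" "a < 1" "a * \<kappa> \<le> \<beta> - n + 1 - \<gamma>"
    and N: "2 * R\<^sup>2 + 1 \<le> a * (N - R\<^sup>2)" "4 * a\<^sup>2 * R\<^sup>2 + 1 \<le> a * (1 - a) * (N - R\<^sup>2)"
    and K: "1 \<le> K" "A * N powr \<bar>\<alpha>\<bar> * (R\<^sup>2 + L\<^sup>2) powr \<bar>\<gamma> / 2\<bar> * R powr (\<beta> - n + 1 - \<gamma> - a * \<kappa>) \<le> K powr \<kappa>"
    and "frontier \<Omega> \<noteq> {}"
  shows "viscosity_subsolution f \<Omega> (halfspace_barrier K a N e y)"
    and "\<And>x. x \<in> closure \<Omega> \<Longrightarrow> - (K * R powr a * N) \<le> halfspace_barrier K a N e y x"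
proof -
  define w where "w = halfspace_barrier K a N e y"
  \<comment> \<open>Places \<open>N - (norm (x - y))\<^sup>2\<close> between 1 and \<open>N\<close>,
    so that the barrier is comparable to \<open>K * T powr a\<close>.\<close>
  have N1: "R\<^sup>2 + 1 \<le> N"
  proof -
    have "0 \<le> R\<^sup>2"
      by simp
    with N(1) have *: "1 \<le> a * (N - R\<^sup>2)"
      by linarith
    then have "0 < N - R\<^sup>2"
      using a(1) by (smt (verit) mult_nonneg_nonpos)
    then have "a * (N - R\<^sup>2) \<le> 1 * (N - R\<^sup>2)"
      using a(2) by (intro mult_right_mono) auto
    with * show ?thesis
      by simp
  qed
  have halfspace_closure: "0 \<le> e \<bullet> (x - y)" and diam_closure: "norm (x - y) \<le> R" if "x \<in> closure \<Omega>" for x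
  proof -
    have "continuous_on (closure \<Omega>) (\<lambda>x. e \<bullet> (x - y))" "continuous_on (closure \<Omega>) (\<lambda>x. norm (x - y))"
      by (intro continuous_intros)+
    then show "0 \<le> e \<bullet> (x - y)" "norm (x - y) \<le> R"
      using continuous_ge_on_closure[of \<Omega> "\<lambda>x. e \<bullet> (x - y)" x 0] halfspace
        continuous_le_on_closure[of \<Omega> "\<lambda>x. norm (x - y)" x R] diam that
      by (auto simp: less_imp_le)
  qed
  have norm_sq: "(norm (x - y))\<^sup>2 \<le> R\<^sup>2" if "x \<in> closure \<Omega>" for x
    using diam_closure[OF that] by (intro power_mono) auto
  have T_le: "e \<bullet> (x - y) \<le> R" if "x \<in> closure \<Omega>" for x
    using norm_cauchy_schwarz[of e "x - y"] e diam_closure[OF that] by simp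
  show "- (K * R powr a * N) \<le> halfspace_barrier K a N e y x" if "x \<in> closure \<Omega>" for x
  proof -
    have "(norm (x - y))\<^sup>2 \<le> N"
      using norm_sq[OF that] N1 by linarith
    then have "K * (e \<bullet> (x - y)) powr a * (N - (norm (x - y))\<^sup>2) \<le> K * R powr a * N"
      using halfspace_closure[OF that] T_le[OF that] K(1) a(1) \<open>1 \<le> R\<close>
      by (intro mult_mono powr_mono2) auto
    then show ?thesis
      by (simp add: halfspace_barrier_def algebra_simps)
  qed
  have w_cont: "continuous_on (closure \<Omega>) w"
    unfolding w_def halfspace_barrier_def using halfspace_closure a(1)
    by (intro continuous_intros continuous_on_powr') auto
  have w_neg: "w x < 0" if "x \<in> \<Omega>" for x
  proof -
    have "x \<in> closure \<Omega>"
      using that closure_subset by auto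
    then show ?thesis
      unfolding w_def halfspace_barrier_def
      using halfspace[OF that] K(1) norm_sq[of x] N1 by (intro mult_pos_neg) auto
  qed
  have D2: "K * (e \<bullet> (x - y)) powr a * (\<xi> \<bullet> \<xi>) + K * (e \<bullet> (x - y)) powr (a - 2) * (e \<bullet> \<xi>)\<^sup>2
      \<le> halfspace_barrier_D2 K a N e y x \<xi>" if "x \<in> \<Omega>" for x \<xi>
  proof -
    have "x \<in> closure \<Omega>"
      using that closure_subset by auto
    have "((x - y) \<bullet> \<xi>)\<^sup>2 \<le> (norm (x - y))\<^sup>2 * (\<xi> \<bullet> \<xi>)"
      using Cauchy_Schwarz_ineq[of "x - y" \<xi>] by (simp add: power2_norm_eq_inner)
    also have "\<dots> \<le> R\<^sup>2 * (\<xi> \<bullet> \<xi>)"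
      using norm_sq[OF \<open>x \<in> closure \<Omega>\<close>] by (intro mult_right_mono) auto
    finally show ?thesis
      unfolding halfspace_barrier_D2_def
      using halfspace[OF that] norm_sq[OF \<open>x \<in> closure \<Omega>\<close>] a(1,2) K(1) N(2) \<open>1 \<le> R\<close>
      by (intro halfspace_barrier_second_derivative_bound[where R = R]) auto
  qed
  have "convex_on \<Omega> w"
  proof (rule convex_on_if_second_derivative_nonneg[OF convex_domain,
        of w "\<lambda>x \<xi> s. halfspace_barrier_D1 K a N e y (x + s *\<^sub>R \<xi>) \<xi>"
          "\<lambda>x \<xi> s. halfspace_barrier_D2 K a N e y (x + s *\<^sub>R \<xi>) \<xi>"])
    fix x \<xi> s assume "x + s *\<^sub>R \<xi> \<in> \<Omega>"
    then show "((\<lambda>s. w (x + s *\<^sub>R \<xi>)) has_real_derivative halfspace_barrier_D1 K a N e y (x + s *\<^sub>R \<xi>) \<xi>) (at s)"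
      "((\<lambda>s. halfspace_barrier_D1 K a N e y (x + s *\<^sub>R \<xi>) \<xi>) has_real_derivative
        halfspace_barrier_D2 K a N e y (x + s *\<^sub>R \<xi>) \<xi>) (at s)"
      unfolding w_def by (intro halfspace_barrier_line_derivatives halfspace; simp)+
    have "0 \<le> K * (e \<bullet> (x + s *\<^sub>R \<xi> - y)) powr a * (\<xi> \<bullet> \<xi>)
        + K * (e \<bullet> (x + s *\<^sub>R \<xi> - y)) powr (a - 2) * (e \<bullet> \<xi>)\<^sup>2"
      using K(1) by (intro add_nonneg_nonneg mult_nonneg_nonneg) auto
    also note D2[OF \<open>x + s *\<^sub>R \<xi> \<in> \<Omega>\<close>]
    finally show "0 \<le> halfspace_barrier_D2 K a N e y (x + s *\<^sub>R \<xi>) \<xi>" .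
  qed
  then have "convex_on (closure \<Omega>) w"
    using w_cont by (rule convex_on_closure)
  then have w_cand: "viscosity_candidate \<Omega> w"
    using w_cont w_neg by (simp add: viscosity_candidate_def)
  have "f x (w x) (gradient \<phi> x) \<le> det (hessian \<phi> x)"
    if x: "x \<in> \<Omega>" and "open V" "x \<in> V" and C2: "C2_on (V \<inter> \<Omega>) \<phi>"
      and min: "\<And>z. z \<in> V \<inter> \<Omega> \<Longrightarrow> \<phi> x - w x \<le> \<phi> z - w z" for x V \<phi>
  proof -
    have x_clos: "x \<in> closure \<Omega>"
      using x closure_subset by auto
    define T where "T = e \<bullet> (x - y)"
    have T: "0 < T" "T \<le> R"
      using halfspace[OF x] T_le[OF x_clos] by (auto simp: T_def)
    have "open (V \<inter> \<Omega>)" "x \<in> V \<inter> \<Omega>"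
      using that open_domain by auto
    then obtain r where r: "0 < r" "ball x r \<subseteq> V \<inter> \<Omega>"
      by (meson openE)
    have in_dom: "z \<in> \<Omega>" if "z \<in> ball x r" for z
      using that r(2) by auto
    have d1: "((\<lambda>s. w (x + s *\<^sub>R \<xi>)) has_real_derivative halfspace_barrier_D1 K a N e y (x + s *\<^sub>R \<xi>) \<xi>) (at s)"
      if "x + s *\<^sub>R \<xi> \<in> ball x r" for \<xi> s
      unfolding w_def by (rule halfspace_barrier_line_derivatives(1)[OF halfspace[OF in_dom[OF that]]])
    have d2: "((\<lambda>s. halfspace_barrier_D1 K a N e y (x + s *\<^sub>R \<xi>) \<xi>) has_real_derivative
        halfspace_barrier_D2 K a N e y x \<xi>) (at 0)" for \<xi>
      using halfspace_barrier_line_derivatives(2)[of e x 0 \<xi> y K a N] halfspace[OF x] by simp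
    have min': "\<phi> x - w x \<le> \<phi> z - w z" if "z \<in> ball x r" for z
      using min that r(2) by blast
    note touch = touching_from_above[OF C2 \<open>x \<in> V \<inter> \<Omega>\<close> r, where w = w, OF d1 d2 min']
    have "gradient \<phi> x \<bullet> \<xi> = ((K * (a * T powr (a - 1) * ((norm (x - y))\<^sup>2 - N))) *\<^sub>R e
        + (K * (2 * T powr a)) *\<^sub>R (x - y)) \<bullet> \<xi>" for \<xi>
      using touch(1)[of \<xi>] by (simp add: halfspace_barrier_D1_def T_def inner_add_left algebra_simps)
    then have grad: "gradient \<phi> x = (K * (a * T powr (a - 1) * ((norm (x - y))\<^sup>2 - N))) *\<^sub>R e
        + (K * (2 * T powr a)) *\<^sub>R (x - y)"
      by (meson vector_eq_rdot)
    have grad_bounds: "K * T powr (a - 1) \<le> norm (gradient \<phi> x)"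
      "norm (gradient \<phi> x) \<le> K * T powr (a - 1) * L"
      unfolding grad L_def
      using halfspace_barrier_gradient_bounds[OF e T diam[OF x] a(1) _ N(1), of K] K(1) by auto
    have w_eq: "\<bar>w x\<bar> = K * T powr a * (N - (norm (x - y))\<^sup>2)"
      using w_neg[OF x] by (simp add: w_def halfspace_barrier_def T_def algebra_simps)
    have "f x (w x) (gradient \<phi> x) \<le> A * infdist x (frontier \<Omega>) powr (\<beta> - n - 1)
        * (K * T powr a * (N - (norm (x - y))\<^sup>2)) powr (- \<alpha>) * (1 + (norm (gradient \<phi> x))\<^sup>2) powr (\<gamma> / 2)"
      using growth[OF x w_neg[OF x], of "gradient \<phi> x"] unfolding w_eq .
    also have "\<dots> \<le> (K * T powr (a - 2)) * (K * T powr a) ^ (CARD('n) - 1)"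
      unfolding n_def
    proof (rule barrier_growth[OF T \<open>1 \<le> R\<close> a(1,2) K(1) \<open>0 < A\<close>])
      have "x \<notin> frontier \<Omega>"
        using x open_domain by (simp add: frontier_def interior_open)
      then show "0 < infdist x (frontier \<Omega>)"
        using \<open>frontier \<Omega> \<noteq> {}\<close> by (intro infdist_pos_not_in_closed) auto
      show "infdist x (frontier \<Omega>) \<le> T"
        unfolding T_def by (rule infdist_frontier_le_hyperplane_distance[OF e halfspace x])
      show "1 \<le> N - (norm (x - y))\<^sup>2" "N - (norm (x - y))\<^sup>2 \<le> N"
        using norm_sq[OF x_clos] N1 by auto
      show "a * (real CARD('n) + \<alpha> - \<gamma>) \<le> \<beta> - real CARD('n) + 1 - \<gamma>"
        using a(3) by (simp add: \<kappa>_def n_def)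
      show "A * N powr \<bar>\<alpha>\<bar> * (R\<^sup>2 + L\<^sup>2) powr \<bar>\<gamma> / 2\<bar>
          * R powr (\<beta> - real CARD('n) + 1 - \<gamma> - a * (real CARD('n) + \<alpha> - \<gamma>))
        \<le> K powr (real CARD('n) + \<alpha> - \<gamma>)"
        using K(2) by (simp add: \<kappa>_def n_def)
    qed (use \<beta> grad_bounds in \<open>auto simp: n_def Suc_le_eq\<close>)
    also have "\<dots> \<le> det (hessian \<phi> x)"
    proof (rule det_ge_rank_one_perturbation[OF hessian_symmetric[OF C2 \<open>x \<in> V \<inter> \<Omega>\<close>] e])
      show "K * T powr a * (\<xi> \<bullet> \<xi>) + K * T powr (a - 2) * (e \<bullet> \<xi>)\<^sup>2 \<le> \<xi> \<bullet> (hessian \<phi> x *v \<xi>)" for \<xi>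
        using D2[OF x, of \<xi>] touch(2)[of \<xi>] by (simp add: T_def)
    qed (use T K(1) in auto)
    finally show ?thesis .
  qed
  then show "viscosity_subsolution f \<Omega> (halfspace_barrier K a N e y)"
    using w_cand unfolding viscosity_subsolution_def w_def[symmetric] by blast
qed

text \<open>A nontrivial supporting hyperplane leaves the relative interior of the closure, here
  \<Omega> itself, strictly on one side. Strictness makes the negative powers of the distance to the
  hyperplane usable throughout \<Omega>.\<close>

lemma supporting_halfspace_open:
  fixes \<Omega> :: "'a::euclidean_space set"
  assumes "open \<Omega>" "convex \<Omega>" "y \<in> frontier \<Omega>"
  obtains e where "norm e = 1" "\<And>x. x \<in> \<Omega> \<Longrightarrow> 0 < e \<bullet> (x - y)"
proof -
  have "rel_interior (closure \<Omega>) = \<Omega>"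
    using assms by (simp add: convex_rel_interior_closure rel_interior_open)
  moreover have "y \<in> closure \<Omega>" "y \<notin> \<Omega>"
    using assms by (auto simp: frontier_def interior_open)
  ultimately obtain b where b: "b \<noteq> 0" "\<And>x. x \<in> \<Omega> \<Longrightarrow> b \<bullet> y < b \<bullet> x"
    using supporting_hyperplane_rel_boundary[of "closure \<Omega>" y] convex_closure[OF assms(2)] by metis
  show thesis
  proof
    show "norm (b /\<^sub>R norm b) = 1"
      using b(1) by simp
    show "0 < (b /\<^sub>R norm b) \<bullet> (x - y)" if "x \<in> \<Omega>" for x
      using b(1) b(2)[OF that] by (simp add: inner_diff_right)
  qed
qed

theorem theorem1p1:
  fixes \<Omega> :: "(real ^ 'n) set"
    and f :: "real ^ 'n \<Rightarrow> real \<Rightarrow> real ^ 'n \<Rightarrow> real"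
    and A \<alpha> \<beta> \<gamma> :: real
  assumes n_ge_2: "CARD('n) \<ge> 2"
    and domain: "open \<Omega>" "\<Omega> \<noteq> {}" "bounded \<Omega>" "convex \<Omega>"
    and f1: "continuous_on (\<Omega> \<times> {..<0} \<times> UNIV) (\<lambda>(x, z, q). f x z q)"
    and f2: "\<And>x q. x \<in> \<Omega> \<Longrightarrow> mono_on {..<0} (\<lambda>z. f x z q)"
    and constants: "A > 0" "\<beta> \<ge> real CARD('n) + 1"
      "\<gamma> < min (real CARD('n) + \<alpha>) (\<beta> - real CARD('n) + 1)"
    and f3: "\<And>x z q. x \<in> \<Omega> \<Longrightarrow> z < 0 \<Longrightarrow>
      0 < f x z q \<and>
      f x z q \<le> A * infdist x (frontier \<Omega>) powr (\<beta> - real CARD('n) - 1)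
        * \<bar>z\<bar> powr (- \<alpha>) * (1 + (norm q)\<^sup>2) powr (\<gamma> / 2)"
  shows "\<exists>u. dirichlet_viscosity_solution f \<Omega> u"
proof -
  interpret monge_ampere \<Omega> f
    using domain f1 f2 f3 by unfold_locales auto
  define \<kappa> where "\<kappa> = real CARD('n) + \<alpha> - \<gamma>"
  define \<mu> where "\<mu> = \<beta> - real CARD('n) + 1 - \<gamma>"
  have pos: "0 < \<kappa>" "0 < \<mu>"
    using constants(3) by (auto simp: \<kappa>_def \<mu>_def)
  \<comment> \<open>\<open>1 / 2\<close> ensures \<open>1 - a \<ge> 1 / 2\<close>;
    \<open>\<mu> / \<kappa>\<close> leaves a nonnegative surplus power of \<open>T\<close> in
    \<open>barrier_growth\<close>.\<close>
  define a where "a = min (1 / 2) (\<mu> / \<kappa>)"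
  have a: "0 < a" "a \<le> 1 / 2" "a * \<kappa> \<le> \<mu>"
    using pos by (auto simp: a_def min_mult_distrib_right intro: order_trans[OF min.cobounded2])
  define R where "R = max 1 (diameter (closure \<Omega>))"
  have "1 \<le> R"
    by (simp add: R_def)
  have R: "norm (x - y) \<le> R" if "x \<in> closure \<Omega>" "y \<in> closure \<Omega>" for x y
    using diameter_bounded_bound[of "closure \<Omega>" x y] that domain(3)
    by (simp add: R_def dist_norm bounded_closure)
  \<comment> \<open>Solved from \<open>a * (N - R\<^sup>2)\<close>, whose value exceeds
    \<open>2 * R\<^sup>2 + 1\<close> and whose half, all that is left by the factor
    \<open>1 - a\<close>, exceeds \<open>4 * a\<^sup>2 * R\<^sup>2 + 1\<close>.\<close>
  define N where "N = R\<^sup>2 + (8 * a\<^sup>2 * R\<^sup>2 + 2 + 4 * R\<^sup>2) / a"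
  have aN: "a * (N - R\<^sup>2) = 8 * a\<^sup>2 * R\<^sup>2 + 2 + 4 * R\<^sup>2"
    using a(1) by (simp add: N_def)
  have N1: "2 * R\<^sup>2 + 1 \<le> a * (N - R\<^sup>2)"
    unfolding aN by (simp add: add_nonneg_nonneg)
  have N2: "4 * a\<^sup>2 * R\<^sup>2 + 1 \<le> a * (1 - a) * (N - R\<^sup>2)"
  proof -
    have "4 * a\<^sup>2 * R\<^sup>2 + 1 \<le> (1 / 2) * (a * (N - R\<^sup>2))"
      unfolding aN by simp
    also have "\<dots> \<le> (1 - a) * (a * (N - R\<^sup>2))"
      using a(2) unfolding aN by (intro mult_right_mono) (auto simp: add_nonneg_nonneg)
    finally show ?thesis
      by (simp add: ac_simps)
  qed
  define C where "C = A * N powr \<bar>\<alpha>\<bar> * (R\<^sup>2 + (a * N + 2 * R\<^sup>2)\<^sup>2) powr \<bar>\<gamma> / 2\<bar> * R powr (\<mu> - a * \<kappa>)"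
  \<comment> \<open>As \<open>\<kappa> > 0\<close>, the condition
    \<open>C \<le> K powr \<kappa>\<close> holds from this threshold on.\<close>
  define K where "K = max 1 (C powr (1 / \<kappa>))"
  have "0 \<le> C"
    using constants(1) by (simp add: C_def)
  have K: "1 \<le> K" "C \<le> K powr \<kappa>"
  proof -
    have "C = (C powr (1 / \<kappa>)) powr \<kappa>"
      using \<open>0 \<le> C\<close> pos(1) by (simp add: powr_powr)
    also have "\<dots> \<le> K powr \<kappa>"
      using pos(1) by (intro powr_mono2) (auto simp: K_def)
    finally show "C \<le> K powr \<kappa>" .
  qed (simp add: K_def)
  have frontier: "frontier \<Omega> \<noteq> {}"
    using domain(2,3) by (intro frontier_not_empty) auto
  show ?thesis
  proof (rule perron[OF _ frontier])
    fix y assume y: "y \<in> frontier \<Omega>"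
    obtain e where e: "norm e = 1" "\<And>x. x \<in> \<Omega> \<Longrightarrow> 0 < e \<bullet> (x - y)"
      using supporting_halfspace_open[OF domain(1,4) y] by blast
    have diam: "norm (x - y) \<le> R" if "x \<in> \<Omega>" for x
      using that y closure_subset by (intro R) (auto simp: frontier_def)
    have \<mu>': "a * (real CARD('n) + \<alpha> - \<gamma>) \<le> \<beta> - real CARD('n) + 1 - \<gamma>"
      using a(3) by (simp add: \<kappa>_def \<mu>_def)
    have K': "A * N powr \<bar>\<alpha>\<bar> * (R\<^sup>2 + (a * N + 2 * R\<^sup>2)\<^sup>2) powr \<bar>\<gamma> / 2\<bar>
        * R powr (\<beta> - real CARD('n) + 1 - \<gamma> - a * (real CARD('n) + \<alpha> - \<gamma>))
      \<le> K powr (real CARD('n) + \<alpha> - \<gamma>)"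
      using K(2) unfolding C_def \<mu>_def \<kappa>_def .
    have "a < 1"
      using a(2) by simp
    note barrier = viscosity_subsolution_halfspace_barrier[OF conjunct2[OF f3] constants(1,2) e diam
        \<open>1 \<le> R\<close> a(1) \<open>a < 1\<close> \<mu>' N1 N2 K(1) K' frontier]
    show "\<exists>w. viscosity_subsolution f \<Omega> w \<and> (\<forall>x\<in>closure \<Omega>. - (K * R powr a * N) \<le> w x) \<and> w y = 0"
      using barrier by (intro exI[of _ "halfspace_barrier K a N e y"]) (simp add: halfspace_barrier_def)
  qed
qed

end
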